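(* There is a family of estimators $(\hat{a}_{n,L} : \Omega^n \to \mathbb{R})_{n \in \mathbb{N}, L > 0}$ with the following property: for all $P \in \mathcal{P}$, there is a neighborhood $\mathcal{N} \subseteq \mathcal{P}$ of $P$ such that for all $T > 0$ one has $$\lim_{L \to \infty} \sup_{Q \in \mathcal{N}} \limsup_{n \to \infty} Q^n\big[n^{1/3} |\hat{a}_{n,L} - a(Q)| > T\big] = 0.$$
   Context: Let $\Omega = [0,1] \times \{\pm 1\}$ with the Borel $\sigma$-field. Let $\tilde{\mathcal{P}}$ be the set of all probability measures $P$ on $\Omega$ having a density $f_P \in C^1([0,1]\times\{\pm 1\})$ with respect to (Lebesgue measure on $[0,1]$) $\otimes$ (counting measure on $\{\pm1\}$). Write $f_P^+ := f_P(\cdot,1)$ and $f_P^- := f_P(\cdot,-1)$. Endow $\tilde{\mathcal{P}}$ with the metric $d(P,Q) := \|f_P - f_Q\|_\infty + \|\partial_1 f_P - \partial_1 f_Q\|_\infty$, where $\partial_1$ is the derivative with respect to the first argument. Let $\mathcal{P} \subseteq \tilde{\mathcal{P}}$ be the set of all $P \in \tilde{\mathcal{P}}$ such that there is a unique point $a(P) \in [0,1]$ with $f_P^+(a(P)) = f_P^-(a(P))$, this point lies in the open interval $(0,1)$, and $(f_P^+)'(a(P)) > (f_P^-)'(a(P))$. $\mathcal{P}$ carries the topology induced by $d$. $Q^n$ denotes the $n$-fold product measure of $Q$ on $\Omega^n$. An estimator is a measurable function $\Omega^n \to \mathbb{R}$. *)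

theory Defs
  imports "HOL-Probability.Probability"
begin

text \<open>The sample space \<open>[0,1] \<times> {\<plusminus>1}\<close> is realised as a subset of \<open>\<real>\<^sup>2\<close>.\<close>

definition Omega :: "(real \<times> real) set" where
  "Omega = {0..1} \<times> {-1, 1}"

text \<open>Only the \<open>\<sigma>\<close>-algebra of this measure matters.\<close>

definition Omega_borel :: "(real \<times> real) measure" where
  "Omega_borel = restrict_space borel Omega"

definition ref_measure :: "(real \<times> real) measure" where
  "ref_measure = restrict_space lborel {0..1} \<Otimes>\<^sub>M count_space {-1, 1}"

text \<open>
  The derivative with respect to the first argument is taken within \<open>[0,1]\<close>, i.e. it is
  one-sided at the endpoints.
\<close>

definition partial1 :: "(real \<times> real \<Rightarrow> real) \<Rightarrow> real \<times> real \<Rightarrow> real" where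
  "partial1 f = (\<lambda>(x, s). vector_derivative (\<lambda>t. f (t, s)) (at x within {0..1}))"

definition C1_Omega :: "(real \<times> real \<Rightarrow> real) \<Rightarrow> bool" where
  "C1_Omega f \<longleftrightarrow>
     (\<forall>s\<in>{-1, 1}. (\<lambda>x. f (x, s)) differentiable_on {0..1} \<and>
                  continuous_on {0..1} (\<lambda>x. partial1 f (x, s)))"

definition is_C1_density :: "(real \<times> real) measure \<Rightarrow> (real \<times> real \<Rightarrow> real) \<Rightarrow> bool" where
  "is_C1_density P f \<longleftrightarrow>
     C1_Omega f \<and> (\<forall>w\<in>Omega. 0 \<le> f w) \<and> P = density ref_measure (\<lambda>w. ennreal (f w))"

definition Ptilde :: "(real \<times> real) measure set" where
  "Ptilde = {P. prob_space P \<and> (\<exists>f. is_C1_density P f)}"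

text \<open>
  The values outside \<^term>\<open>Omega\<close> are irrelevant; on \<^term>\<open>Omega\<close> the continuous density is
  unique, see \<open>dens_eq\<close> below.
\<close>

definition dens :: "(real \<times> real) measure \<Rightarrow> real \<times> real \<Rightarrow> real" where
  "dens P = (SOME f. is_C1_density P f)"

definition sup_norm_Omega :: "(real \<times> real \<Rightarrow> real) \<Rightarrow> real" where
  "sup_norm_Omega f = (SUP w\<in>Omega. \<bar>f w\<bar>)"

text \<open>
  The value \<open>0\<close> outside \<^term>\<open>Ptilde\<close> is a dummy: \<^locale>\<open>Metric_space\<close> asks for
  nonnegativity on the whole type.
\<close>

definition P_dist :: "(real \<times> real) measure \<Rightarrow> (real \<times> real) measure \<Rightarrow> real" where
  "P_dist P Q =
     (if P \<in> Ptilde \<and> Q \<in> Ptilde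
      then sup_norm_Omega (\<lambda>w. dens P w - dens Q w) +
           sup_norm_Omega (\<lambda>w. partial1 (dens P) w - partial1 (dens Q) w)
      else 0)"

definition crossing :: "(real \<times> real) measure \<Rightarrow> real" where
  "crossing P = (THE x. x \<in> {0..1} \<and> dens P (x, 1) = dens P (x, -1))"

definition calP :: "(real \<times> real) measure set" where
  "calP = {P \<in> Ptilde.
     (\<exists>!x. x \<in> {0..1} \<and> dens P (x, 1) = dens P (x, -1)) \<and>
     crossing P \<in> {0<..<1} \<and>
     partial1 (dens P) (crossing P, 1) > partial1 (dens P) (crossing P, -1)}"

definition calP_topology :: "(real \<times> real) measure topology" where
  "calP_topology = subtopology (Metric_space.mtopology Ptilde P_dist) calP"

definition is_neighbourhood :: "'a topology \<Rightarrow> 'a \<Rightarrow> 'a set \<Rightarrow> bool" where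
  "is_neighbourhood X x N \<longleftrightarrow> N \<subseteq> topspace X \<and> (\<exists>U. openin X U \<and> x \<in> U \<and> U \<subseteq> N)"

definition product_power :: "'a measure \<Rightarrow> nat \<Rightarrow> (nat \<Rightarrow> 'a) measure" where
  "product_power M n = (\<Pi>\<^sub>M i\<in>{..<n}. M)"

definition is_estimator :: "nat \<Rightarrow> ((nat \<Rightarrow> real \<times> real) \<Rightarrow> real) \<Rightarrow> bool" where
  "is_estimator n g \<longleftrightarrow> g \<in> borel_measurable (product_power Omega_borel n)"

subsection \<open>Well-definedness\<close>

lemma space_ref_measure: "space ref_measure = Omega"
  by (simp add: ref_measure_def Omega_def space_pair_measure)

lemma sets_ref_measure: "sets ref_measure = sets Omega_borel"
proof -
  have 1: "(\<lambda>p. p) \<in> measurable ref_measure Omega_borel"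
    unfolding Omega_borel_def
  proof (rule measurable_restrict_space2)
    show "(\<lambda>p. p) \<in> space ref_measure \<rightarrow> Omega"
      by (simp add: space_ref_measure)
    have "(\<lambda>p. fst p) \<in> borel_measurable ref_measure"
      unfolding ref_measure_def
      by (rule measurable_compose[OF measurable_fst]) (simp add: measurable_restrict_space1)
    moreover have "(\<lambda>p. snd p) \<in> borel_measurable ref_measure"
      unfolding ref_measure_def
      by (rule measurable_compose[OF measurable_snd]) simp
    ultimately have "(\<lambda>p. (fst p, snd p)) \<in> measurable ref_measure (borel \<Otimes>\<^sub>M borel)"
      by (rule measurable_Pair)
    thus "(\<lambda>p. p) \<in> borel_measurable ref_measure"
      by (simp add: borel_prod)
  qed
  have 2: "(\<lambda>p. p) \<in> measurable Omega_borel ref_measure"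
  proof -
    have bf: "(fst :: real \<times> real \<Rightarrow> real) \<in> borel_measurable borel"
      by (intro borel_measurable_continuous_onI continuous_on_fst continuous_on_id)
    have bs: "(snd :: real \<times> real \<Rightarrow> real) \<in> borel_measurable borel"
      by (intro borel_measurable_continuous_onI continuous_on_snd continuous_on_id)
    have f: "fst \<in> measurable Omega_borel (restrict_space lborel {0..1})"
    proof (rule measurable_restrict_space2)
      show "fst \<in> space Omega_borel \<rightarrow> {0..1}"
        by (auto simp: Omega_borel_def Omega_def space_restrict_space)
      show "fst \<in> measurable Omega_borel lborel"
        unfolding Omega_borel_def using bf by (simp add: measurable_restrict_space1)
    qed
    have s': "snd \<in> borel_measurable Omega_borel"
      unfolding Omega_borel_def using bs by (rule measurable_restrict_space1)
    have s: "snd \<in> measurable Omega_borel (count_space {-1, 1})"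
    proof (subst measurable_count_space_eq2, simp, intro conjI ballI)
      show "snd \<in> space Omega_borel \<rightarrow> {-1, 1}"
        by (auto simp: Omega_borel_def Omega_def space_restrict_space)
      fix a :: real
      show "snd -` {a} \<inter> space Omega_borel \<in> sets Omega_borel"
        using measurable_sets[OF s', of "{a}"] by simp
    qed
    from measurable_Pair[OF f s] show ?thesis by (simp add: ref_measure_def)
  qed
  have sp: "space ref_measure = space Omega_borel"
    by (simp add: space_ref_measure Omega_borel_def space_restrict_space)
  show ?thesis
  proof (intro equalityI subsetI)
    fix A assume "A \<in> sets ref_measure"
    from measurable_sets[OF 2 this] sets.sets_into_space[OF this] sp
    show "A \<in> sets Omega_borel" by (simp add: Int_absorb2)
  next
    fix A assume "A \<in> sets Omega_borel"
    from measurable_sets[OF 1 this] sets.sets_into_space[OF this] sp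
    show "A \<in> sets ref_measure" by (simp add: Int_absorb2)
  qed
qed

lemma C1_Omega_continuous:
  assumes "C1_Omega f" "s \<in> {-1, 1}"
  shows "continuous_on {0..1} (\<lambda>x. f (x, s))"
  using assms unfolding C1_Omega_def by (blast intro: differentiable_imp_continuous_on)

lemma C1_Omega_measurable:
  assumes "C1_Omega f"
  shows "f \<in> borel_measurable ref_measure"
proof -
  have "(\<lambda>p. f (snd p, fst p)) \<in> borel_measurable (count_space {-1, 1} \<Otimes>\<^sub>M restrict_space lborel {0..1})"
  proof (rule measurable_pair_measure_countable1)
    fix s :: real assume "s \<in> {-1, 1}"
    hence "(\<lambda>x. f (x, s)) \<in> borel_measurable (restrict_space borel {0..1})"
      by (intro borel_measurable_continuous_on_restrict C1_Omega_continuous assms)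
    moreover have "sets (restrict_space lborel {0..1::real}) = sets (restrict_space borel {0..1})"
      by (intro sets_restrict_space_cong) simp
    ultimately have "(\<lambda>x. f (x, s)) \<in> borel_measurable (restrict_space lborel {0..1})"
      using measurable_cong_sets[OF _ refl] by blast
    thus "(\<lambda>x. f (snd (s, x), fst (s, x))) \<in> borel_measurable (restrict_space lborel {0..1})"
      by simp
  qed simp
  from measurable_pair_swap[OF this] show ?thesis
    by (simp add: ref_measure_def case_prod_beta)
qed

lemma C1_density_unique:
  assumes f: "is_C1_density P f" and g: "is_C1_density P g" and w: "w \<in> Omega"
  shows "f w = g w"
proof -
  interpret A: sigma_finite_measure "restrict_space lborel {0..1::real}"
    by (rule sigma_finite_measure_restrict_space) (auto intro: lborel.sigma_finite_measure_axioms)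
  interpret B: sigma_finite_measure "count_space {-1, 1::real}"
    by (rule sigma_finite_measure_count_space_finite) simp
  interpret pair_sigma_finite "restrict_space lborel {0..1::real}" "count_space {-1, 1::real}" ..
  interpret R: sigma_finite_measure ref_measure
    unfolding ref_measure_def
    by (rule sigma_finite_pair_measure) (rule A.sigma_finite_measure_axioms B.sigma_finite_measure_axioms)+
  note f' = f[unfolded is_C1_density_def] and g' = g[unfolded is_C1_density_def]
  have mf: "f \<in> borel_measurable ref_measure" and mg: "g \<in> borel_measurable ref_measure"
    using f' g' C1_Omega_measurable by auto
  have "AE w in ref_measure. ennreal (f w) = ennreal (g w)"
    using f' g' mf mg by (intro R.density_unique) auto
  with AE_space[of ref_measure] have "AE w in ref_measure. f w = g w"
    by eventually_elim (use f' g' in \<open>auto simp: space_ref_measure\<close>)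
  hence "AE w in restrict_space lborel {0..1} \<Otimes>\<^sub>M count_space {-1, 1}. f w = g w"
    unfolding ref_measure_def .
  from AE_pair[OF this]
  have ae: "AE x in lborel. x \<in> {0..1} \<longrightarrow> (\<forall>s\<in>{-1, 1}. f (x, s) = g (x, s))"
    by (simp add: AE_restrict_space_iff AE_count_space del: AE_conj_iff)
  obtain x s where xs: "w = (x, s)" "x \<in> {0..1}" "s \<in> {-1, 1}"
    using w by (auto simp: Omega_def)
  define C where "C = {x \<in> {0..1}. f (x, s) - g (x, s) = 0}"
  have "continuous_on {0..1} (\<lambda>x. f (x, s) - g (x, s))"
    using f' g' xs by (intro continuous_on_diff C1_Omega_continuous) auto
  hence C: "closed C"
    unfolding C_def by (rule continuous_closed_preimage_constant) simp
  have "AE x in lborel. x \<in> {0<..<1} \<longrightarrow> x \<in> C"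
    using ae by eventually_elim (use xs in \<open>auto simp: C_def\<close>)
  hence *: "AE x \<in> {0<..<1} in lebesgue. x \<in> C"
    by (rule AE_completion)
  have "{0<..<1} \<subseteq> C"
    using mem_closed_if_AE_lebesgue_open[OF open_greaterThanLessThan C *] by auto
  with C have "closure {0<..<1} \<subseteq> C" by (rule closure_minimal[rotated])
  thus ?thesis using xs by (auto simp: C_def)
qed

lemma is_C1_density_dens: "P \<in> Ptilde \<Longrightarrow> is_C1_density P (dens P)"
  using someI_ex[of "is_C1_density P"] by (simp add: dens_def Ptilde_def)

lemma dens_eq: "P \<in> Ptilde \<Longrightarrow> is_C1_density P f \<Longrightarrow> w \<in> Omega \<Longrightarrow> dens P w = f w"
  using C1_density_unique is_C1_density_dens by blast

lemma sup_norm_Omega_props: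
  assumes "\<And>s. s \<in> {-1, 1} \<Longrightarrow> continuous_on {0..1} (\<lambda>x. h (x, s))"
  shows sup_norm_Omega_bdd: "bdd_above ((\<lambda>w. \<bar>h w\<bar>) ` Omega)"
    and sup_norm_Omega_nonneg: "0 \<le> sup_norm_Omega h"
proof -
  have "bdd_above ((\<lambda>x. \<bar>h (x, s)\<bar>) ` {0..1})" if "s \<in> {-1, 1}" for s
    by (intro bounded_imp_bdd_above compact_imp_bounded compact_continuous_image
          continuous_on_rabs assms that) simp
  moreover have "(\<lambda>w. \<bar>h w\<bar>) ` Omega =
      (\<lambda>x. \<bar>h (x, -1)\<bar>) ` {0..1} \<union> (\<lambda>x. \<bar>h (x, 1)\<bar>) ` {0..1}"
    by (auto simp: Omega_def)
  ultimately show bdd: "bdd_above ((\<lambda>w. \<bar>h w\<bar>) ` Omega)" by simp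
  have "(0, 1) \<in> Omega" by (simp add: Omega_def)
  from cSUP_upper[OF this bdd] show "0 \<le> sup_norm_Omega h"
    unfolding sup_norm_Omega_def by linarith
qed

lemma sup_norm_Omega_commute:
  "sup_norm_Omega (\<lambda>w. u w - v w) = sup_norm_Omega (\<lambda>w. v w - u w)"
  by (simp add: sup_norm_Omega_def abs_minus_commute)

lemma sup_norm_Omega_triangle:
  assumes "\<And>s. s \<in> {-1, 1} \<Longrightarrow> continuous_on {0..1} (\<lambda>x. u (x, s))"
    and "\<And>s. s \<in> {-1, 1} \<Longrightarrow> continuous_on {0..1} (\<lambda>x. v (x, s))"
    and "\<And>s. s \<in> {-1, 1} \<Longrightarrow> continuous_on {0..1} (\<lambda>x. t (x, s))"
  shows "sup_norm_Omega (\<lambda>w. u w - t w) \<le>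
         sup_norm_Omega (\<lambda>w. u w - v w) + sup_norm_Omega (\<lambda>w. v w - t w)"
  unfolding sup_norm_Omega_def[of "\<lambda>w. u w - t w"]
proof (rule cSUP_least)
  show "Omega \<noteq> {}" by (simp add: Omega_def)
  fix w assume w: "w \<in> Omega"
  have "\<bar>u w - v w\<bar> \<le> sup_norm_Omega (\<lambda>w. u w - v w)"
    unfolding sup_norm_Omega_def
    by (rule cSUP_upper[OF w sup_norm_Omega_bdd]) (intro continuous_on_diff assms)
  moreover have "\<bar>v w - t w\<bar> \<le> sup_norm_Omega (\<lambda>w. v w - t w)"
    unfolding sup_norm_Omega_def
    by (rule cSUP_upper[OF w sup_norm_Omega_bdd]) (intro continuous_on_diff assms)
  ultimately show "\<bar>u w - t w\<bar> \<le>
         sup_norm_Omega (\<lambda>w. u w - v w) + sup_norm_Omega (\<lambda>w. v w - t w)" by linarith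
qed

lemma Metric_space_Ptilde: "Metric_space Ptilde P_dist"
proof -
  have c: "continuous_on {0..1} (\<lambda>x. dens P (x, s))"
          "continuous_on {0..1} (\<lambda>x. partial1 (dens P) (x, s))"
    if "P \<in> Ptilde" "s \<in> {-1, 1}" for P s
  proof -
    have "C1_Omega (dens P)"
      using is_C1_density_dens[OF that(1)] by (simp add: is_C1_density_def)
    thus "continuous_on {0..1} (\<lambda>x. dens P (x, s))"
         "continuous_on {0..1} (\<lambda>x. partial1 (dens P) (x, s))"
      using that(2) C1_Omega_continuous[of "dens P" s] by (blast, unfold C1_Omega_def) blast
  qed
  have nn: "0 \<le> sup_norm_Omega (\<lambda>w. dens P w - dens Q w)"
           "0 \<le> sup_norm_Omega (\<lambda>w. partial1 (dens P) w - partial1 (dens Q) w)"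
    if "P \<in> Ptilde" "Q \<in> Ptilde" for P Q
    by (rule sup_norm_Omega_nonneg, intro continuous_on_diff c that; assumption)+
  show ?thesis
  proof
    show "0 \<le> P_dist P Q" for P Q
      using nn[of P Q] by (auto simp: P_dist_def)
    show "P_dist P Q = P_dist Q P" for P Q
      by (simp add: P_dist_def sup_norm_Omega_commute[of "dens P"]
            sup_norm_Omega_commute[of "partial1 (dens P)"])
    show "P_dist P Q = 0 \<longleftrightarrow> P = Q" if PQ: "P \<in> Ptilde" "Q \<in> Ptilde" for P Q
    proof
      assume "P = Q"
      thus "P_dist P Q = 0" by (simp add: P_dist_def sup_norm_Omega_def Omega_def)
    next
      assume "P_dist P Q = 0"
      hence 0: "sup_norm_Omega (\<lambda>w. dens P w - dens Q w) = 0"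
        using nn[OF PQ] PQ by (simp add: P_dist_def add_nonneg_eq_0_iff)
      have "dens P w = dens Q w" if w: "w \<in> Omega" for w
      proof -
        have "\<bar>dens P w - dens Q w\<bar> \<le> sup_norm_Omega (\<lambda>w. dens P w - dens Q w)"
          unfolding sup_norm_Omega_def
          by (rule cSUP_upper[OF w sup_norm_Omega_bdd]) (intro continuous_on_diff c PQ)
        thus ?thesis using 0 by simp
      qed
      hence "density ref_measure (\<lambda>w. ennreal (dens P w)) = density ref_measure (\<lambda>w. ennreal (dens Q w))"
        using is_C1_density_dens[OF PQ(1)] is_C1_density_dens[OF PQ(2)]
        by (intro density_cong)
           (auto simp: is_C1_density_def space_ref_measure
              intro!: AE_I2 measurable_compose[OF C1_Omega_measurable measurable_ennreal])
      thus "P = Q"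
        using is_C1_density_dens[OF PQ(1)] is_C1_density_dens[OF PQ(2)]
        by (simp add: is_C1_density_def)
    qed
    show "P_dist P R \<le> P_dist P Q + P_dist Q R"
      if PQR: "P \<in> Ptilde" "Q \<in> Ptilde" "R \<in> Ptilde" for P Q R
    proof -
      have "sup_norm_Omega (\<lambda>w. dens P w - dens R w) \<le>
            sup_norm_Omega (\<lambda>w. dens P w - dens Q w) + sup_norm_Omega (\<lambda>w. dens Q w - dens R w)"
        by (rule sup_norm_Omega_triangle; intro c(1) PQR; assumption)
      moreover have "sup_norm_Omega (\<lambda>w. partial1 (dens P) w - partial1 (dens R) w) \<le>
            sup_norm_Omega (\<lambda>w. partial1 (dens P) w - partial1 (dens Q) w) +
            sup_norm_Omega (\<lambda>w. partial1 (dens Q) w - partial1 (dens R) w)"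
        by (rule sup_norm_Omega_triangle; intro c(2) PQR; assumption)
      ultimately show ?thesis using PQR by (simp add: P_dist_def)
    qed
  qed
qed

lemma topspace_calP_topology: "topspace calP_topology = calP"
proof -
  interpret Metric_space Ptilde P_dist by (rule Metric_space_Ptilde)
  show ?thesis by (auto simp: calP_topology_def calP_def)
qed

end

theory Submission
  imports Defs
begin

text \<open>
  With bandwidth \<open>h = L n powr (-1/3)\<close> let \<open>S(x)\<close> be the sum of the signs of those observations whose position
  lies within \<open>h\<close> of \<open>x\<close>, and let the estimator be the length of \<open>{x \<in> [0,1]. S(x) < 0}\<close>. Since
  \<open>f\<^sup>+ - f\<^sup>-\<close> is negative to the left of the crossing point \<open>a\<close> and positive to its right, the estimation
  error is at most the length of the set of all \<open>x\<close> where \<open>S(x)\<close> has the wrong sign. By Fubini and Markov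
  it therefore suffices to bound the integral over \<open>x\<close> of the probability of a wrong sign at \<open>x\<close>.

  Let \<open>m\<close> be the slope of \<open>f\<^sup>+ - f\<^sup>-\<close> at \<open>a\<close>. As the window is symmetric, the mean of \<open>S(x)\<close> is
  \<open>2 n h m (x - a)\<close> up to an error \<open>n o(h\<^sup>2)\<close>, and its variance is \<open>O(n h)\<close>. By Chebyshev's inequality the
  probability of a wrong sign is at most \<open>min 1 (B\<^sup>2 / (x - a)\<^sup>2)\<close> with \<open>B = O(1 / (m \<surd>(n h)))\<close> once
  \<open>\<bar>x - a\<bar>\<close> exceeds some \<open>o(h)\<close>, and it is \<open>O(1 / (n h))\<close> away from \<open>a\<close>. The expected error is thus
  \<open>O(B) + o(h)\<close>, that is, \<open>n powr (-1/3) (O(1 / \<surd>L) + o(1))\<close>. Only the constant in \<open>O(1 / \<surd>L)\<close> has to be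
  uniform in a neighbourhood, and it depends just on an upper bound for the density and a lower bound
  for the slope.
\<close>

section \<open>Second moments and Chebyshev's inequality for sums of independent copies\<close>

text \<open>Expanding the square gives a double sum over pairs of coordinates. By independence each
  off-diagonal term is a product of two vanishing means, so only the \<open>n\<close> diagonal terms
  survive. Boundedness of \<open>Z\<close> provides the integrability.\<close>

lemma (in prob_space) product_power_sum_second_moment:
  fixes Z :: "'a \<Rightarrow> real"
  assumes [measurable]: "Z \<in> borel_measurable M" and bdd: "\<And>x. x \<in> space M \<Longrightarrow> \<bar>Z x\<bar> \<le> B"
    and mean: "expectation Z = 0"
  shows "integrable (product_power M n) (\<lambda>w. (\<Sum>i<n. Z (w i))\<^sup>2)"
    and "(\<integral>w. (\<Sum>i<n. Z (w i))\<^sup>2 \<partial>product_power M n) = n * expectation (\<lambda>x. (Z x)\<^sup>2)"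
proof -
  interpret product_sigma_finite "\<lambda>_::nat. M"
    by (simp add: product_sigma_finite_def sigma_finite_measure_axioms)
  have int: "integrable M Z" "integrable M (\<lambda>x. (Z x)\<^sup>2)"
  proof -
    show "integrable M Z"
      by (rule integrable_const_bound[where B=B]) (auto intro!: AE_I2 bdd)
    have "\<bar>Z x\<bar>\<^sup>2 \<le> B\<^sup>2" if "x \<in> space M" for x
      using bdd[OF that] by (intro power_mono) auto
    then show "integrable M (\<lambda>x. (Z x)\<^sup>2)"
      by (intro integrable_const_bound[where B="B\<^sup>2"]) (auto intro!: AE_I2)
  qed
  \<comment> \<open>\<open>F i j\<close> spreads the product \<open>Z (w i) * Z (w j)\<close> over
    all \<open>n\<close> coordinates, with the constant 1 elsewhere. This makes it a full product,
    whose integral factorises; on the diagonal the single relevant factor is the square.\<close>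
  define F where "F i j k = (if k = i then if i = j then \<lambda>x. (Z x)\<^sup>2 else Z
      else if k = j then Z else (\<lambda>_. 1))" for i j k :: nat
  have intF: "integrable M (F i j k)" for i j k
    using int by (auto simp: F_def)
  have prodF: "(\<Prod>k<n. F i j k (w k)) = Z (w i) * Z (w j)" if "i < n" "j < n" for i j and w :: "nat \<Rightarrow> 'a"
  proof -
    have "(\<Prod>k<n. F i j k (w k)) = (\<Prod>k\<in>{i,j}. F i j k (w k))"
      using that by (intro prod.mono_neutral_right) (auto simp: F_def)
    then show ?thesis
      by (cases "i = j") (auto simp: F_def power2_eq_square)
  qed
  have intZZ: "integrable (product_power M n) (\<lambda>w. Z (w i) * Z (w j))" if "i < n" "j < n" for i j
  proof -
    have "integrable (product_power M n) (\<lambda>w. \<Prod>k<n. F i j k (w k))"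
      unfolding product_power_def by (intro product_integrable_prod) (auto intro: intF)
    then show ?thesis
      by (simp add: prodF[OF that])
  qed
  have EZZ: "(\<integral>w. Z (w i) * Z (w j) \<partial>product_power M n) =
      (if i = j then expectation (\<lambda>x. (Z x)\<^sup>2) else 0)" if "i < n" "j < n" for i j
  proof -
    have "(\<integral>w. Z (w i) * Z (w j) \<partial>product_power M n) = (\<integral>w. (\<Prod>k<n. F i j k (w k)) \<partial>product_power M n)"
      by (simp add: prodF[OF that])
    also have "\<dots> = (\<Prod>k<n. expectation (F i j k))"
      unfolding product_power_def by (intro product_integral_prod) (auto intro: intF)
    also have "\<dots> = (\<Prod>k\<in>{i,j}. expectation (F i j k))"
      using that by (intro prod.mono_neutral_right) (auto simp: F_def prob_space)
    also have "\<dots> = (if i = j then expectation (\<lambda>x. (Z x)\<^sup>2) else 0)"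
      by (auto simp: F_def mean)
    finally show ?thesis .
  qed
  have sq: "(\<lambda>w. (\<Sum>i<n. Z (w i))\<^sup>2) = (\<lambda>w. \<Sum>i<n. \<Sum>j<n. Z (w i) * Z (w j))"
    by (simp add: power2_eq_square sum_product)
  show "integrable (product_power M n) (\<lambda>w. (\<Sum>i<n. Z (w i))\<^sup>2)"
    unfolding sq by (intro Bochner_Integration.integrable_sum) (auto intro: intZZ)
  have "(\<integral>w. (\<Sum>i<n. Z (w i))\<^sup>2 \<partial>product_power M n) =
      (\<Sum>i<n. \<Sum>j<n. \<integral>w. Z (w i) * Z (w j) \<partial>product_power M n)"
    unfolding sq
    by (subst Bochner_Integration.integral_sum;
        auto intro!: Bochner_Integration.integrable_sum intZZ sum.cong Bochner_Integration.integral_sum)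
  also have "\<dots> = (\<Sum>i<n. \<Sum>j<n. if i = j then expectation (\<lambda>x. (Z x)\<^sup>2) else 0)"
    by (intro sum.cong refl) (auto simp: EZZ)
  also have "\<dots> = n * expectation (\<lambda>x. (Z x)\<^sup>2)"
    by simp
  finally show "(\<integral>w. (\<Sum>i<n. Z (w i))\<^sup>2 \<partial>product_power M n) = n * expectation (\<lambda>x. (Z x)\<^sup>2)" .
qed

text \<open>Chebyshev's inequality for the centred sum. The variance is replaced by the larger
  uncentred second moment, which for the window terms used below is simply the mass of the
  window.\<close>

lemma (in prob_space) product_power_mean_deviation:
  fixes Y :: "'a \<Rightarrow> real"
  assumes [measurable]: "Y \<in> borel_measurable M" and bdd: "\<And>x. x \<in> space M \<Longrightarrow> \<bar>Y x\<bar> \<le> B"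
    and n: "n > 0" and c: "c > 0"
  shows "emeasure (product_power M n)
      {w \<in> space (product_power M n). real n * c \<le> \<bar>(\<Sum>i<n. Y (w i)) - real n * expectation Y\<bar>}
    \<le> ennreal (expectation (\<lambda>x. (Y x)\<^sup>2) / (real n * c\<^sup>2))" (is "emeasure ?P ?A \<le> _")
proof -
  define \<mu> where "\<mu> = expectation Y"
  define Z where "Z = (\<lambda>x. Y x - \<mu>)"
  have intY: "integrable M Y"
    by (rule integrable_const_bound[where B=B]) (auto intro!: AE_I2 bdd)
  have "\<bar>Y x\<bar>\<^sup>2 \<le> B\<^sup>2" if "x \<in> space M" for x
    using bdd[OF that] by (intro power_mono) auto
  then have intY2: "integrable M (\<lambda>x. (Y x)\<^sup>2)"
    by (intro integrable_const_bound[where B="B\<^sup>2"]) (auto intro!: AE_I2)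
  have meas: "Z \<in> borel_measurable M"
    by (simp add: Z_def)
  have bddZ: "\<bar>Z x\<bar> \<le> B + \<bar>\<mu>\<bar>" if "x \<in> space M" for x
    using bdd[OF that] by (simp add: Z_def)
  have mean: "expectation Z = 0"
    using intY by (simp add: Z_def \<mu>_def prob_space)
  have Z2: "expectation (\<lambda>x. (Z x)\<^sup>2) \<le> expectation (\<lambda>x. (Y x)\<^sup>2)"
    using variance_eq[OF intY intY2] by (simp add: Z_def \<mu>_def)
  have A: "?A = {w \<in> space ?P. (real n * c)\<^sup>2 \<le> (\<Sum>i<n. Z (w i))\<^sup>2}"
  proof -
    have "(\<Sum>i<n. Y (w i)) - real n * \<mu> = (\<Sum>i<n. Z (w i))" for w :: "nat \<Rightarrow> 'a"
      by (simp add: Z_def sum_subtractf)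
    moreover have "(real n * c \<le> \<bar>s\<bar>) \<longleftrightarrow> ((real n * c)\<^sup>2 \<le> s\<^sup>2)" for s
      using c abs_le_square_iff[of "real n * c" s] by simp
    ultimately show ?thesis
      unfolding \<mu>_def by auto
  qed
  have "emeasure ?P ?A \<le> (1 / (real n * c)\<^sup>2) * (\<integral>w. (\<Sum>i<n. Z (w i))\<^sup>2 \<partial>?P)"
    unfolding A
    by (intro integral_Markov_inequality product_power_sum_second_moment[OF meas bddZ mean])
       (use n c in auto)
  also have "\<dots> = ennreal (expectation (\<lambda>x. (Z x)\<^sup>2) / (real n * c\<^sup>2))"
    using n by (subst product_power_sum_second_moment(2)[OF meas bddZ mean])
      (auto simp: power_mult_distrib power2_eq_square[of "real n"])
  also have "\<dots> \<le> ennreal (expectation (\<lambda>x. (Y x)\<^sup>2) / (real n * c\<^sup>2))"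
    using n c by (intro ennreal_leI divide_right_mono Z2) auto
  finally show ?thesis .
qed

section \<open>From wrong signs to the error of the estimator\<close>

text \<open>The negativity set of \<open>S w\<close> and the interval from 0 to \<open>a\<close>
  differ, apart from the null set {a}, only on the set \<open>W w\<close> of wrong signs, so their
  lengths differ by at most the length \<open>u w\<close> of \<open>W w\<close>. Markov's inequality
  bounds the probability that \<open>u w\<close> is large by its integral, and Fubini turns that
  integral into one over \<open>x\<close> of the probability of a wrong sign at
  \<open>x\<close>.\<close>

lemma emeasure_sign_change_deviation:
  fixes S :: "'a \<Rightarrow> real \<Rightarrow> real"
  assumes "sigma_finite_measure M"
    and S[measurable]: "case_prod S \<in> borel_measurable (M \<Otimes>\<^sub>M borel)"
    and a: "a \<in> {0..1}" and r: "r > 0" and T: "T > 0"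
  shows "emeasure M {w \<in> space M. T < r * \<bar>measure lborel {x \<in> {0..1}. S w x < 0} - a\<bar>}
    \<le> ennreal (r / T) *
       (\<integral>\<^sup>+x\<in>{0..1}. emeasure M {w \<in> space M. x < a \<and> 0 \<le> S w x \<or> a < x \<and> S w x < 0} \<partial>lborel)"
proof -
  interpret sigma_finite_measure M by fact
  interpret pair_sigma_finite M "lborel :: real measure" ..
  have S'[measurable]: "case_prod S \<in> borel_measurable (M \<Otimes>\<^sub>M lborel)"
    using S by (simp cong: measurable_cong_sets)
  define W where "W w = {x \<in> {0..1}. x < a \<and> 0 \<le> S w x \<or> a < x \<and> S w x < 0}" for w
  have [measurable]: "(\<lambda>(w, x). indicator (W w) x :: ennreal) \<in> borel_measurable (M \<Otimes>\<^sub>M lborel)"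
    unfolding W_def indicator_def by measurable
  define u where "u w = (\<integral>\<^sup>+x. indicator (W w) x \<partial>lborel)" for w
  have [measurable]: "u \<in> borel_measurable M"
    unfolding u_def by measurable
  have key: "ennreal \<bar>measure lborel {x \<in> {0..1}. S w x < 0} - a\<bar> \<le> u w" if w: "w \<in> space M" for w
  proof -
    have [measurable]: "S w \<in> borel_measurable borel"
      using S w by (rule measurable_Pair2[of "case_prod S", simplified])
    define A where "A = {x \<in> {0..1}. S w x < 0}"
    have setsA: "A \<in> sets lborel" and setsW: "W w \<in> sets lborel"
    proof -
      have "{x \<in> space lborel. x \<in> {0..1} \<and> S w x < 0} \<in> sets lborel"
        by measurable
      then show "A \<in> sets lborel"
        by (simp add: A_def)
      have "{x \<in> space lborel. x \<in> {0..1} \<and> (x < a \<and> 0 \<le> S w x \<or> a < x \<and> S w x < 0)} \<in> sets lborel"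
        by measurable
      then show "W w \<in> sets lborel"
        by (simp add: W_def)
    qed
    have icc: "{0..c} \<in> fmeasurable lborel" for c :: real
      by (intro fmeasurableI) (auto simp: emeasure_lborel_Icc_eq)
    have fin: "A \<in> fmeasurable lborel" "W w \<in> fmeasurable lborel"
      by (rule fmeasurableI2[OF icc[of 1]], use setsA setsW in \<open>auto simp: A_def W_def\<close>)+
    have "A \<subseteq> {0..a} \<union> W w"
      by (auto simp: A_def W_def)
    then have "measure lborel A \<le> measure lborel ({0..a} \<union> W w)"
      using fin icc by (intro measure_mono_fmeasurable setsA fmeasurable.Un) auto
    also have "\<dots> \<le> measure lborel {0..a} + measure lborel (W w)"
      using setsW by (intro measure_Un_le) auto
    finally have 1: "measure lborel A \<le> a + measure lborel (W w)"
      using a by simp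
    have "{0..<a} \<subseteq> A \<union> W w"
      using a by (auto simp: A_def W_def)
    then have "measure lborel {0..<a} \<le> measure lborel (A \<union> W w)"
      using fin by (intro measure_mono_fmeasurable fmeasurable.Un) auto
    also have "\<dots> \<le> measure lborel A + measure lborel (W w)"
      using setsW setsA by (intro measure_Un_le) auto
    finally have "a \<le> measure lborel A + measure lborel (W w)"
      using a by simp
    with 1 have "\<bar>measure lborel A - a\<bar> \<le> measure lborel (W w)"
      by linarith
    then have "ennreal \<bar>measure lborel A - a\<bar> \<le> ennreal (measure lborel (W w))"
      by (rule ennreal_leI)
    also have "\<dots> = u w"
      unfolding u_def using setsW fin by (simp add: emeasure_eq_measure2)
    finally show ?thesis
      by (simp add: A_def)
  qed
  have "emeasure M {w \<in> space M. T < r * \<bar>measure lborel {x \<in> {0..1}. S w x < 0} - a\<bar>}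
      \<le> emeasure M {w \<in> space M. 1 \<le> ennreal (r / T) * u w}"
  proof (rule emeasure_mono)
    show "{w \<in> space M. T < r * \<bar>measure lborel {x \<in> {0..1}. S w x < 0} - a\<bar>}
      \<subseteq> {w \<in> space M. 1 \<le> ennreal (r / T) * u w}"
    proof safe
      fix w assume w: "w \<in> space M" and lt: "T < r * \<bar>measure lborel {x \<in> {0..1}. S w x < 0} - a\<bar>"
      have "1 \<le> ennreal (r / T * \<bar>measure lborel {x \<in> {0..1}. S w x < 0} - a\<bar>)"
        using lt r T by (simp add: field_simps)
      also have "\<dots> = ennreal (r / T) * ennreal \<bar>measure lborel {x \<in> {0..1}. S w x < 0} - a\<bar>"
        using r T by (intro ennreal_mult) auto
      also have "\<dots> \<le> ennreal (r / T) * u w"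
        by (intro mult_left_mono key w) auto
      finally show "1 \<le> ennreal (r / T) * u w" .
    qed
  qed measurable
  also have "\<dots> \<le> ennreal (r / T) * (\<integral>\<^sup>+w. u w * indicator (space M) w \<partial>M)"
    by (intro nn_integral_Markov_inequality) auto
  also have "(\<integral>\<^sup>+w. u w * indicator (space M) w \<partial>M) = (\<integral>\<^sup>+w. u w \<partial>M)"
    by (intro nn_integral_cong) auto
  also have "(\<integral>\<^sup>+w. u w \<partial>M) = (\<integral>\<^sup>+x. (\<integral>\<^sup>+w. indicator (W w) x \<partial>M) \<partial>lborel)"
    unfolding u_def by (intro Fubini'[symmetric]) simp
  also have "\<dots> = (\<integral>\<^sup>+x\<in>{0..1}. emeasure M {w \<in> space M. x < a \<and> 0 \<le> S w x \<or> a < x \<and> S w x < 0} \<partial>lborel)"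
  proof (intro nn_integral_cong)
    fix x :: real
    have m: "{w \<in> space M. x < a \<and> 0 \<le> S w x \<or> a < x \<and> S w x < 0} \<in> sets M"
    proof -
      have [measurable]: "(\<lambda>w. S w x) \<in> borel_measurable M"
        using measurable_Pair1[OF S, of x] by simp
      show ?thesis by measurable
    qed
    have "(\<integral>\<^sup>+w. indicator (W w) x \<partial>M) =
      (\<integral>\<^sup>+w. indicator {w \<in> space M. x < a \<and> 0 \<le> S w x \<or> a < x \<and> S w x < 0} w * indicator {0..1} x \<partial>M)"
      by (intro nn_integral_cong) (auto simp: W_def indicator_def)
    also have "\<dots> = emeasure M {w \<in> space M. x < a \<and> 0 \<le> S w x \<or> a < x \<and> S w x < 0} * indicator {0..1} x"
      using m by (simp add: nn_integral_multc)
    finally show "(\<integral>\<^sup>+w. indicator (W w) x \<partial>M) = \<dots>" .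
  qed
  finally show ?thesis .
qed

section \<open>The integral of the density difference over a window\<close>

text \<open>Over the symmetric window the linear part integrates to exactly
  \<open>2 * h * m * (x - a)\<close>, and the remainder to at most
  \<open>2 * h * e * (\<bar>x - a\<bar> + h)\<close>. The bound \<open>e \<le> m / 4\<close> and the
  lower bound on \<open>\<bar>x - a\<bar>\<close> each make one summand of this remainder at most a
  quarter of the main term, so at least half of the main term is left.\<close>

lemma window_integral_near:
  fixes g :: "real \<Rightarrow> real"
  assumes cont: "continuous_on {x - h..x + h} g" and h: "0 < h" and m: "0 < m"
    and near: "\<And>t. t \<in> {x - h..x + h} \<Longrightarrow> \<bar>g t - m * (t - a)\<bar> \<le> e * \<bar>t - a\<bar>"
    and e: "0 < e" "e \<le> m / 4" and far: "4 * e * h / m \<le> \<bar>x - a\<bar>"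
  shows "m * h * \<bar>x - a\<bar> \<le> sgn (x - a) * integral {x - h..x + h} g"
proof -
  have "norm (integral {x - h..x + h} (\<lambda>t. g t - m * (t - a))) \<le> (e * (\<bar>x - a\<bar> + h)) * ((x + h) - (x - h))"
  proof (rule integral_bound)
    fix t assume t: "t \<in> {x - h..x + h}"
    have "e * \<bar>t - a\<bar> \<le> e * (\<bar>x - a\<bar> + h)"
      using t e by (intro mult_left_mono) auto
    with near[OF t] show "norm (g t - m * (t - a)) \<le> e * (\<bar>x - a\<bar> + h)"
      by simp
  qed (use h in \<open>auto intro!: continuous_intros cont\<close>)
  moreover have "((\<lambda>t. m * (t - a)) has_integral (m * (x + h - a)\<^sup>2 / 2 - m * (x - h - a)\<^sup>2 / 2)) {x - h..x + h}"
    using h by (intro fundamental_theorem_of_calculus)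
      (auto intro!: derivative_eq_intros simp flip: has_real_derivative_iff_has_vector_derivative)
  then have "integral {x - h..x + h} (\<lambda>t. m * (t - a)) = 2 * h * m * (x - a)"
    by (simp add: integral_unique power2_eq_square field_simps)
  then have "integral {x - h..x + h} (\<lambda>t. g t - m * (t - a)) = integral {x - h..x + h} g - 2 * h * m * (x - a)"
    by (subst integral_diff) (auto intro!: integrable_continuous_interval continuous_intros cont)
  ultimately have *: "\<bar>integral {x - h..x + h} g - 2 * h * m * (x - a)\<bar> \<le> 2 * h * e * (\<bar>x - a\<bar> + h)"
    by (simp add: mult_ac)
  have "e * h \<le> m * \<bar>x - a\<bar> / 4"
    using far m by (simp add: field_simps)
  moreover have "e * \<bar>x - a\<bar> \<le> m / 4 * \<bar>x - a\<bar>"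
    using e by (intro mult_right_mono) auto
  ultimately have "e * (\<bar>x - a\<bar> + h) \<le> m * \<bar>x - a\<bar> / 2"
    by (simp add: algebra_simps)
  then have "2 * h * (e * (\<bar>x - a\<bar> + h)) \<le> 2 * h * (m * \<bar>x - a\<bar> / 2)"
    using h by (intro mult_left_mono) auto
  with * have **: "\<bar>integral {x - h..x + h} g - 2 * h * m * (x - a)\<bar> \<le> m * h * \<bar>x - a\<bar>"
    by (simp add: mult_ac)
  have "0 < \<bar>x - a\<bar> \<or> x = a"
    by auto
  then show ?thesis
  proof (elim disjE)
    assume "0 < \<bar>x - a\<bar>"
    then consider "x > a" | "x < a" by linarith
    then show ?thesis
      using ** by cases (auto simp: sgn_if algebra_simps)
  qed simp
qed

text \<open>Close to \<open>a\<close> the linearisation of \<open>g\<close> controls the window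
  integral. Farther away \<open>g\<close> has a constant sign on each side, since a sign change
  would give a second zero, and by compactness \<open>\<bar>g\<bar>\<close> stays above some
  \<open>\<gamma>\<close>.\<close>

lemma crossing_window_bounds:
  fixes g :: "real \<Rightarrow> real"
  assumes cont: "continuous_on {0..1} g" and a: "0 < a" "a < 1" and ga: "g a = 0"
    and unique: "\<And>t. t \<in> {0..1} \<Longrightarrow> g t = 0 \<Longrightarrow> t = a"
    and deriv: "(g has_real_derivative m) (at a within {0..1})" and e: "0 < e" "e \<le> m / 4"
  obtains \<delta> \<gamma> where "0 < \<delta>" "0 < \<gamma>"
    "\<And>x h. \<lbrakk>0 < h; h \<le> \<delta>; x \<in> {0..1}; \<bar>x - a\<bar> \<le> 2 * \<delta>; 4 * e * h / m \<le> \<bar>x - a\<bar>\<rbrakk> \<Longrightarrow>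
      m * h * \<bar>x - a\<bar> \<le> sgn (x - a) * integral {max 0 (x - h)..min 1 (x + h)} g"
    "\<And>x h. \<lbrakk>0 < h; h \<le> \<delta>; x \<in> {0..1}; 2 * \<delta> < \<bar>x - a\<bar>\<rbrakk> \<Longrightarrow>
      \<gamma> * h \<le> sgn (x - a) * integral {max 0 (x - h)..min 1 (x + h)} g"
proof -
  have m: "m > 0"
    using e by simp
  obtain d where d: "d > 0" and
    "\<And>t. t \<in> {0..1} \<Longrightarrow> \<bar>t - a\<bar> < d \<Longrightarrow> \<bar>g t - g a - m * (t - a)\<bar> \<le> e * \<bar>t - a\<bar>"
    using deriv e unfolding has_field_derivative_def has_derivative_within_alt real_norm_def by blast
  then have lin: "\<bar>g t - m * (t - a)\<bar> \<le> e * \<bar>t - a\<bar>" if "t \<in> {0..1}" "\<bar>t - a\<bar> < d" for t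
    using that ga by simp
  \<comment> \<open>If \<open>\<bar>x - a\<bar> \<le> 2 * \<delta>\<close> and
    \<open>h \<le> \<delta>\<close>, the window stays within \<open>3 * \<delta>\<close> of
    \<open>a\<close>. Dividing by 4 thus keeps it inside the unit interval and inside the range of
    the linearisation.\<close>
  define \<delta> where "\<delta> = min d (min a (1 - a)) / 4"
  have \<delta>: "\<delta> > 0" "4 * \<delta> \<le> d" "4 * \<delta> \<le> a" "4 * \<delta> \<le> 1 - a"
    using d a by (auto simp: \<delta>_def)
  have sub: "continuous_on {p..q} g" if "0 \<le> p" "q \<le> 1" for p q
    by (rule continuous_on_subset[OF cont]) (use that in auto)
  \<comment> \<open>The linearisation already makes \<open>g\<close> positive at
    \<open>a + \<delta>\<close>; a nonpositive value further right would force another zero by the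
    intermediate value theorem.\<close>
  have pos: "g t > 0" if t: "t \<in> {a + \<delta>..1}" for t
  proof (rule ccontr)
    assume "\<not> g t > 0"
    moreover have "g (a + \<delta>) > 0"
    proof -
      have "\<bar>g (a + \<delta>) - m * \<delta>\<bar> \<le> e * \<delta>"
        using lin[of "a + \<delta>"] \<delta> a by simp
      moreover have "e * \<delta> \<le> m / 4 * \<delta>"
        using e \<delta> by (intro mult_right_mono) auto
      moreover have "m * \<delta> > 0"
        using m \<delta> by simp
      ultimately show ?thesis
        by linarith
    qed
    ultimately obtain s where "a + \<delta> \<le> s" "s \<le> t" "g s = 0"
      using IVT2'[of g t 0 "a + \<delta>"] sub[of "a + \<delta>" t] t a \<delta> by auto
    then show False
      using unique[of s] t a \<delta> by auto
  qed
  have neg: "g t < 0" if t: "t \<in> {0..a - \<delta>}" for t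
  proof (rule ccontr)
    assume "\<not> g t < 0"
    moreover have "g (a - \<delta>) < 0"
    proof -
      have "\<bar>g (a - \<delta>) + m * \<delta>\<bar> \<le> e * \<delta>"
        using lin[of "a - \<delta>"] \<delta> a by simp
      moreover have "e * \<delta> \<le> m / 4 * \<delta>"
        using e \<delta> by (intro mult_right_mono) auto
      moreover have "m * \<delta> > 0"
        using m \<delta> by simp
      ultimately show ?thesis
        by linarith
    qed
    ultimately obtain s where "t \<le> s" "s \<le> a - \<delta>" "g s = 0"
      using IVT2'[of g "a - \<delta>" 0 t] sub[of t "a - \<delta>"] t a \<delta> by auto
    then show False
      using unique[of s] t a \<delta> by auto
  qed
  define K where "K = {0..a - \<delta>} \<union> {a + \<delta>..1}"
  have "continuous_on K (\<lambda>t. \<bar>g t\<bar>)"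
    using a \<delta> by (intro continuous_intros continuous_on_subset[OF cont]) (auto simp: K_def)
  moreover have "compact K" "K \<noteq> {}"
    using a \<delta> by (auto simp: K_def compact_Un)
  ultimately obtain s where s: "s \<in> K" "\<And>t. t \<in> K \<Longrightarrow> \<bar>g s\<bar> \<le> \<bar>g t\<bar>"
    using continuous_attains_inf[of K "\<lambda>t. \<bar>g t\<bar>"] by auto
  define \<gamma> where "\<gamma> = \<bar>g s\<bar>"
  have \<gamma>: "\<gamma> > 0"
    using s(1) pos[of s] neg[of s] by (auto simp: \<gamma>_def K_def)
  show thesis
  proof (rule that[OF \<delta>(1) \<gamma>])
    fix x h assume h: "0 < h" "h \<le> \<delta>" and x: "x \<in> {0..1}" "\<bar>x - a\<bar> \<le> 2 * \<delta>" "4 * e * h / m \<le> \<bar>x - a\<bar>"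
    have "0 \<le> x - h" "x + h \<le> 1"
      using h x \<delta> by linarith+
    moreover have "m * h * \<bar>x - a\<bar> \<le> sgn (x - a) * integral {x - h..x + h} g"
    proof (rule window_integral_near[OF sub h(1) m lin e x(3)])
      fix t assume "t \<in> {x - h..x + h}"
      then show "t \<in> {0..1}" "\<bar>t - a\<bar> < d"
        using h x \<delta> by (auto simp: abs_if split: if_splits)
    qed fact+
    ultimately show "m * h * \<bar>x - a\<bar> \<le> sgn (x - a) * integral {max 0 (x - h)..min 1 (x + h)} g"
      by (simp add: max_def min_def)
  next
    fix x h assume h: "0 < h" "h \<le> \<delta>" and x: "x \<in> {0..1}" "2 * \<delta> < \<bar>x - a\<bar>"
    \<comment> \<open>Such a window lies on one side of \<open>a\<close>, at distance at least
      \<open>\<delta>\<close> from it. As \<open>x\<close> lies in the unit interval and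
      \<open>h\<close> is small, clipping leaves at least one half of the window, of length
      \<open>h\<close>.\<close>
    define p q where "p = max 0 (x - h)" and "q = min 1 (x + h)"
    have pq: "p \<le> q" "0 \<le> p" "q \<le> 1" "h \<le> q - p"
      using h x \<delta> by (auto simp: p_def q_def min_def max_def)
    have len: "\<gamma> * h \<le> \<gamma> * (q - p)"
      using pq \<gamma> by (intro mult_left_mono) auto
    consider "x > a" | "x < a"
      using x \<delta> by linarith
    then show "\<gamma> * h \<le> sgn (x - a) * integral {max 0 (x - h)..min 1 (x + h)} g"
      unfolding p_def[symmetric] q_def[symmetric]
    proof cases
      case 1
      have "integral {p..q} (\<lambda>_. \<gamma>) \<le> integral {p..q} g"
      proof (intro integral_le integrable_continuous_interval sub pq continuous_intros)
        fix t assume "t \<in> {p..q}"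
        then have t: "t \<in> {a + \<delta>..1}"
          using 1 h x by (auto simp: p_def q_def)
        with pos[OF t] s(2)[of t] show "\<gamma> \<le> g t"
          by (auto simp: K_def \<gamma>_def)
      qed
      then show "\<gamma> * h \<le> sgn (x - a) * integral {p..q} g"
        using 1 len pq by (simp add: mult_ac)
    next
      case 2
      have "integral {p..q} g \<le> integral {p..q} (\<lambda>_. - \<gamma>)"
      proof (intro integral_le integrable_continuous_interval sub pq continuous_intros)
        fix t assume "t \<in> {p..q}"
        then have t: "t \<in> {0..a - \<delta>}"
          using 2 h x by (auto simp: p_def q_def)
        with neg[OF t] s(2)[of t] show "g t \<le> - \<gamma>"
          by (auto simp: K_def \<gamma>_def)
      qed
      then show "\<gamma> * h \<le> sgn (x - a) * integral {p..q} g"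
        using 2 len pq by (simp add: mult_ac)
    qed
  qed
qed

section \<open>Integrating a truncated inverse square\<close>

text \<open>The range \<open>\<bar>x - a\<bar> \<le> c\<close> contributes at most its length
  \<open>2 * c\<close>. Elsewhere the maximum is at most a sum, in which the inverse square is still
  truncated at 1; this truncation makes its integral of order \<open>B\<close>, although the inverse
  square itself is not integrable near \<open>a\<close>.\<close>

lemma nn_integral_inverse_square_truncated_le:
  fixes p :: "real \<Rightarrow> ennreal"
  assumes h: "0 \<le> c" and B: "0 < B" and D: "0 \<le> D"
    and le1: "\<And>x. p x \<le> 1"
    and near: "\<And>x. x \<in> {0..1} \<Longrightarrow> c < \<bar>x - a\<bar> \<Longrightarrow> p x \<le> max (ennreal (B\<^sup>2 / (x - a)\<^sup>2)) (ennreal D)"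
  shows "(\<integral>\<^sup>+x\<in>{0..1}. p x \<partial>lborel) \<le> ennreal (2 * c + 2 * pi * B + D)"
proof -
  \<comment> \<open>\<open>min 1 (B\<^sup>2 / u\<^sup>2) \<le> 2 B\<^sup>2 / (B\<^sup>2 + u\<^sup>2)\<close>, whose primitive is a bounded arctangent\<close>
  define q where "q x = 2 * B\<^sup>2 / (B\<^sup>2 + (x - a)\<^sup>2)" for x
  have q0: "0 \<le> q x" for x
    by (simp add: q_def)
  have [measurable]: "q \<in> borel_measurable borel"
    unfolding q_def by measurable
  have trunc: "min 1 (B\<^sup>2 / (x - a)\<^sup>2) \<le> q x" if "x \<noteq> a" for x
  proof (cases "(x - a)\<^sup>2 \<le> B\<^sup>2")
    case True
    then have "1 \<le> q x"
      using B by (simp add: q_def add_pos_nonneg)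
    then show ?thesis by simp
  next
    case False
    have "2 * B\<^sup>2 / (2 * (x - a)\<^sup>2) \<le> q x"
      unfolding q_def using False that B by (intro divide_left_mono) (auto intro!: add_pos_nonneg mult_pos_pos)
    then show ?thesis by simp
  qed
  have "p x * indicator {0..1} x \<le>
      indicator {a - c..a + c} x + (ennreal (q x) * indicator {0..1} x + ennreal D * indicator {0..1} x)" for x
  proof (cases "x \<in> {0..1} \<and> c < \<bar>x - a\<bar>")
    case True
    then have "p x \<le> max (ennreal (B\<^sup>2 / (x - a)\<^sup>2)) (ennreal D)"
      by (intro near) auto
    then have "p x \<le> min 1 (ennreal (B\<^sup>2 / (x - a)\<^sup>2)) + ennreal D"
      using le1[of x] by (auto simp: min_def max_def add_increasing add_increasing2 split: if_splits)
    also have "min 1 (ennreal (B\<^sup>2 / (x - a)\<^sup>2)) = ennreal (min 1 (B\<^sup>2 / (x - a)\<^sup>2))"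
      by (simp flip: ennreal_1 add: min_def)
    also have "\<dots> \<le> ennreal (q x)"
      using True h by (intro ennreal_leI trunc) auto
    finally show ?thesis
      using True by (simp add: add_increasing)
  next
    case False
    show ?thesis
    proof (cases "x \<in> {0..1}")
      case True
      with False have "x \<in> {a - c..a + c}" by auto
      then show ?thesis
        using le1[of x] True by (simp add: add_increasing2)
    qed simp
  qed
  then have "(\<integral>\<^sup>+x\<in>{0..1}. p x \<partial>lborel) \<le>
      (\<integral>\<^sup>+x. indicator {a - c..a + c} x + (ennreal (q x) * indicator {0..1} x + ennreal D * indicator {0..1} x) \<partial>lborel)"
    by (intro nn_integral_mono) auto
  also have "\<dots> = (\<integral>\<^sup>+x. indicator {a - c..a + c} x \<partial>lborel) +
      (\<integral>\<^sup>+x. (ennreal (q x) * indicator {0..1} x + ennreal D * indicator {0..1} x) \<partial>lborel)"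
    by (rule nn_integral_add) measurable
  also have "(\<integral>\<^sup>+x. (ennreal (q x) * indicator {0..1} x + ennreal D * indicator {0..1} x) \<partial>lborel) =
      (\<integral>\<^sup>+x. ennreal (q x) * indicator {0..1} x \<partial>lborel) + (\<integral>\<^sup>+x. ennreal D * indicator {0..1::real} x \<partial>lborel)"
    by (rule nn_integral_add) measurable
  also have "(\<integral>\<^sup>+x. indicator {a - c..a + c} x \<partial>lborel) = ennreal (2 * c)"
    using h by simp
  also have "(\<integral>\<^sup>+x. ennreal D * indicator {0..1::real} x \<partial>lborel) = ennreal D"
    by (simp add: nn_integral_cmult)
  also have "(\<integral>\<^sup>+x. ennreal (q x) * indicator {0..1} x \<partial>lborel) =
      ennreal (2 * B * arctan ((1 - a) / B) - 2 * B * arctan ((0 - a) / B))"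
  proof (rule nn_integral_FTC_Icc)
    show "((\<lambda>x. 2 * B * arctan ((x - a) / B)) has_real_derivative q x) (at x)" for x
    proof -
      have "((\<lambda>x. 2 * B * arctan ((x - a) / B)) has_real_derivative
          2 * B * (inverse (1 + ((x - a) / B)\<^sup>2) * (1 / B))) (at x)"
        using B by (auto intro!: derivative_eq_intros)
      moreover have "2 * B * (inverse (1 + ((x - a) / B)\<^sup>2) * (1 / B)) = q x"
      proof -
        have "1 + ((x - a) / B)\<^sup>2 = (B\<^sup>2 + (x - a)\<^sup>2) / B\<^sup>2"
          using B by (simp add: power_divide add_divide_distrib)
        then show ?thesis
          using B by (simp add: q_def)
      qed
      ultimately show ?thesis
        by simp
    qed
  qed (auto simp: q0)
  also have "\<dots> \<le> ennreal (2 * pi * B)"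
  proof (rule ennreal_leI)
    have "arctan ((1 - a) / B) - arctan ((0 - a) / B) \<le> pi"
      using arctan_ubound[of "(1 - a) / B"] arctan_lbound[of "(0 - a) / B"] by linarith
    then have "2 * B * (arctan ((1 - a) / B) - arctan ((0 - a) / B)) \<le> 2 * B * pi"
      using B by (intro mult_left_mono) auto
    then show "2 * B * arctan ((1 - a) / B) - 2 * B * arctan ((0 - a) / B) \<le> 2 * pi * B"
      by (simp add: algebra_simps)
  qed
  finally show ?thesis
    using h B D by (simp add: add_left_mono add_right_mono ennreal_plus[symmetric] add.assoc
      del: ennreal_plus)
qed

section \<open>Expectations as integrals of the density\<close>

lemma ref_measure_sigma_finite: "pair_sigma_finite (restrict_space lborel {0..1::real}) (count_space {-1, 1::real})"
  by (intro pair_sigma_finite.intro sigma_finite_measure_restrict_space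
      sigma_finite_measure_count_space_finite lborel.sigma_finite_measure_axioms) auto

lemma sets_Ptilde: "Q \<in> Ptilde \<Longrightarrow> sets Q = sets Omega_borel"
  using is_C1_density_dens[of Q] sets_ref_measure by (metis is_C1_density_def sets_density)

lemma integral_Ptilde:
  fixes F :: "real \<times> real \<Rightarrow> real"
  assumes Q: "Q \<in> Ptilde" and F: "F \<in> borel_measurable Omega_borel"
    and bdd: "\<And>w. w \<in> Omega \<Longrightarrow> \<bar>F w\<bar> \<le> B"
  shows "(\<integral>w. F w \<partial>Q) = (\<integral>x. indicator {0..1} x * (F (x, 1) * dens Q (x, 1) + F (x, -1) * dens Q (x, -1)) \<partial>lborel)"
proof -
  interpret pair_sigma_finite "restrict_space lborel {0..1::real}" "count_space {-1, 1::real}"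
    by (rule ref_measure_sigma_finite)
  interpret Q: prob_space Q
    using Q by (simp add: Ptilde_def)
  have D: "C1_Omega (dens Q)" "\<And>w. w \<in> Omega \<Longrightarrow> 0 \<le> dens Q w"
    "Q = density ref_measure (\<lambda>w. ennreal (dens Q w))"
    using is_C1_density_dens[OF Q] by (auto simp: is_C1_density_def)
  have [measurable]: "dens Q \<in> borel_measurable ref_measure" "F \<in> borel_measurable ref_measure"
    using C1_Omega_measurable[OF D(1)] F measurable_cong_sets[OF sets_ref_measure refl] by auto
  have AE: "AE w in ref_measure. 0 \<le> dens Q w"
    using D(2) by (intro AE_I2) (simp add: space_ref_measure)
  have spQ: "space Q = Omega"
    by (metis D(3) space_density space_ref_measure)
  have "integrable Q F"
    using F bdd spQ by (intro Q.integrable_const_bound[where B=B] AE_I2)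
      (auto simp: measurable_cong_sets[OF sets_Ptilde[OF Q] refl])
  then have int: "integrable ref_measure (\<lambda>w. dens Q w * F w)"
    by (subst (asm) D(3)) (simp add: integrable_density AE)
  have "(\<integral>w. F w \<partial>Q) = (\<integral>w. dens Q w * F w \<partial>ref_measure)"
    by (subst D(3)) (simp add: integral_density AE)
  also have "\<dots> = (\<integral>x. (\<integral>s. dens Q (x, s) * F (x, s) \<partial>count_space {-1, 1}) \<partial>restrict_space lborel {0..1})"
    using int unfolding ref_measure_def by (simp add: integral_fst'[symmetric])
  also have "\<dots> = (\<integral>x. (F (x, 1) * dens Q (x, 1) + F (x, -1) * dens Q (x, -1)) \<partial>restrict_space lborel {0..1})"
    by (simp add: lebesgue_integral_count_space_finite mult_ac add_ac)
  also have "\<dots> = (\<integral>x. indicator {0..1} x * (F (x, 1) * dens Q (x, 1) + F (x, -1) * dens Q (x, -1)) \<partial>lborel)"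
    by (simp add: integral_restrict_space)
  finally show ?thesis .
qed

lemma window_term_measurable:
  assumes [measurable]: "u \<in> borel_measurable borel"
  shows "(\<lambda>w. if \<bar>fst w - x\<bar> \<le> h then u (snd w) else 0 :: real) \<in> borel_measurable Omega_borel"
proof -
  have [measurable]: "(fst :: real \<times> real \<Rightarrow> real) \<in> borel_measurable borel"
      "(snd :: real \<times> real \<Rightarrow> real) \<in> borel_measurable borel"
    by (auto intro!: borel_measurable_continuous_onI continuous_intros)
  have "(\<lambda>w. if \<bar>fst w - x\<bar> \<le> h then u (snd w) else 0 :: real) \<in> borel_measurable (borel :: (real \<times> real) measure)"
    by measurable
  then show ?thesis
    unfolding Omega_borel_def by (rule measurable_restrict_space1)
qed

text \<open>Taking \<open>u\<close> to be the identity gives the mean of a window term, and taking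
  \<open>u\<close> to be the square gives its second moment. The right-hand side is a gauge
  integral, the form in which the window estimates are stated.\<close>

lemma expectation_window:
  assumes Q: "Q \<in> Ptilde" and u: "u \<in> borel_measurable borel"
  shows "(\<integral>w. (if \<bar>fst w - x\<bar> \<le> h then u (snd w) else 0) \<partial>Q) =
    integral {max 0 (x - h)..min 1 (x + h)} (\<lambda>t. u 1 * dens Q (t, 1) + u (-1) * dens Q (t, -1))"
proof -
  let ?W = "{max 0 (x - h)..min 1 (x + h)}"
  let ?f = "\<lambda>t. u 1 * dens Q (t, 1) + u (-1) * dens Q (t, -1)"
  have C1: "C1_Omega (dens Q)"
    using is_C1_density_dens[OF Q] by (simp add: is_C1_density_def)
  have "(\<integral>w. (if \<bar>fst w - x\<bar> \<le> h then u (snd w) else 0) \<partial>Q) = (\<integral>t. indicator ?W t *\<^sub>R ?f t \<partial>lborel)"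
  proof (subst integral_Ptilde[OF Q window_term_measurable[OF u], where B="max \<bar>u 1\<bar> \<bar>u (-1)\<bar>"])
    show "(\<integral>t. indicator {0..1} t * ((if \<bar>fst (t, 1) - x\<bar> \<le> h then u (snd (t, 1 :: real)) else 0) * dens Q (t, 1) +
        (if \<bar>fst (t, - 1) - x\<bar> \<le> h then u (snd (t, - 1 :: real)) else 0) * dens Q (t, - 1)) \<partial>lborel) =
      (\<integral>t. indicator ?W t *\<^sub>R ?f t \<partial>lborel)"
      by (intro Bochner_Integration.integral_cong) (auto simp: indicator_def)
  qed (auto simp: Omega_def)
  also have "\<dots> = integral ?W ?f"
  proof -
    have "continuous_on ?W ?f"
      by (intro continuous_intros continuous_on_subset[OF C1_Omega_continuous[OF C1]]) auto
    then have "set_integrable lborel ?W ?f"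
      by (rule borel_integrable_atLeastAtMost')
    from set_borel_integral_eq_integral(2)[OF this] show ?thesis
      by (simp add: set_lebesgue_integral_def)
  qed
  finally show ?thesis .
qed

section \<open>The estimator and its probability of a wrong sign\<close>

definition window_sum :: "nat \<Rightarrow> real \<Rightarrow> (nat \<Rightarrow> real \<times> real) \<Rightarrow> real \<Rightarrow> real" where
  "window_sum n h w x = (\<Sum>i<n. if \<bar>fst (w i) - x\<bar> \<le> h then snd (w i) else 0)"

text \<open>A length is well defined however often the window sum changes sign, so no particular
  sign change has to be selected.\<close>

definition sign_change_estimator :: "nat \<Rightarrow> real \<Rightarrow> (nat \<Rightarrow> real \<times> real) \<Rightarrow> real" where
  "sign_change_estimator n h w = measure lborel {x \<in> {0..1}. window_sum n h w x < 0}"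

lemma window_sum_measurable:
  assumes "sets M = sets Omega_borel"
  shows "case_prod (window_sum n h) \<in> borel_measurable (product_power M n \<Otimes>\<^sub>M borel)"
proof -
  have [measurable]: "fst \<in> borel_measurable M" "snd \<in> borel_measurable M"
    unfolding measurable_cong_sets[OF assms refl] Omega_borel_def
    by (auto intro!: measurable_restrict_space1 borel_measurable_continuous_onI continuous_intros)
  show ?thesis
    unfolding window_sum_def product_power_def by measurable
qed

text \<open>The length is the integral over \<open>x\<close> of an indicator that is jointly
  measurable in the sample and \<open>x\<close>, hence measurable in the sample.\<close>

lemma sign_change_estimator_measurable: "is_estimator n (sign_change_estimator n h)"
proof -
  let ?M = "product_power Omega_borel n"
  have [measurable]: "case_prod (window_sum n h) \<in> borel_measurable (?M \<Otimes>\<^sub>M lborel)"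
    using window_sum_measurable[OF refl, of n h] by (simp cong: measurable_cong_sets)
  have "(\<lambda>w. enn2real (\<integral>\<^sup>+x. (if x \<in> {0..1} \<and> window_sum n h w x < 0 then 1 else 0) \<partial>lborel)) \<in> borel_measurable ?M"
    by measurable
  moreover have "sign_change_estimator n h w =
      enn2real (\<integral>\<^sup>+x. (if x \<in> {0..1} \<and> window_sum n h w x < 0 then 1 else 0) \<partial>lborel)"
    if w: "w \<in> space ?M" for w
  proof -
    have [measurable]: "window_sum n h w \<in> borel_measurable borel"
      using measurable_Pair2[OF window_sum_measurable[OF refl, of n h] w] by simp
    have "{x \<in> space lborel. x \<in> {0..1} \<and> window_sum n h w x < 0} \<in> sets lborel"
      by measurable
    then have "emeasure lborel {x \<in> {0..1}. window_sum n h w x < 0} =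
        (\<integral>\<^sup>+x. indicator {x \<in> {0..1}. window_sum n h w x < 0} x \<partial>lborel)"
      by simp
    also have "\<dots> = (\<integral>\<^sup>+x. (if x \<in> {0..1} \<and> window_sum n h w x < 0 then 1 else 0) \<partial>lborel)"
      by (intro nn_integral_cong) (auto simp: indicator_def)
    finally show ?thesis
      by (simp add: sign_change_estimator_def measure_def)
  qed
  ultimately show ?thesis
    unfolding is_estimator_def by (subst measurable_cong) auto
qed

text \<open>The sum has mean at most \<open>- n * c\<close> left of \<open>a\<close> and at least
  \<open>n * c\<close> right of it, so a wrong sign is a deviation of at least \<open>n * c\<close>
  and Chebyshev's inequality applies. The factor \<open>4 * C * h\<close> bounds the second moment:
  two densities, each at most \<open>C\<close>, over a window of length at most
  \<open>2 * h\<close>.\<close>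

lemma wrong_sign_probability:
  assumes Q: "Q \<in> Ptilde" and C: "\<And>w. w \<in> Omega \<Longrightarrow> dens Q w \<le> C"
    and n: "n > 0" and h: "0 < h" and x: "x \<in> {0..1}" and c: "c > 0"
    and le: "c \<le> sgn (x - a) * integral {max 0 (x - h)..min 1 (x + h)} (\<lambda>t. dens Q (t, 1) - dens Q (t, -1))"
  shows "emeasure (product_power Q n) {w \<in> space (product_power Q n).
      x < a \<and> 0 \<le> window_sum n h w x \<or> a < x \<and> window_sum n h w x < 0} \<le> ennreal (4 * C * h / (real n * c\<^sup>2))"
proof -
  let ?P = "product_power Q n" and ?W = "{max 0 (x - h)..min 1 (x + h)}"
  interpret prob_space Q
    using Q by (simp add: Ptilde_def)
  have D: "C1_Omega (dens Q)" "\<And>w. w \<in> Omega \<Longrightarrow> 0 \<le> dens Q w"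
    using is_C1_density_dens[OF Q] by (auto simp: is_C1_density_def)
  define Y :: "real \<times> real \<Rightarrow> real" where "Y w = (if \<bar>fst w - x\<bar> \<le> h then snd w else 0)" for w
  have Ymeas[measurable]: "Y \<in> borel_measurable Q"
    unfolding Y_def measurable_cong_sets[OF sets_Ptilde[OF Q] refl]
    by (rule window_term_measurable) simp
  have "space Q = Omega"
    using sets_eq_imp_space_eq[OF sets_Ptilde[OF Q]] by (simp add: Omega_borel_def space_restrict_space)
  then have bdd: "\<bar>Y w\<bar> \<le> 1" if "w \<in> space Q" for w
    using that by (auto simp: Y_def Omega_def)
  have EY: "expectation Y = integral ?W (\<lambda>t. dens Q (t, 1) - dens Q (t, -1))"
    unfolding Y_def using expectation_window[OF Q, of "\<lambda>s. s" x h] by simp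
  \<comment> \<open>The square of either sign is 1, so the second moment is the mass of the
    window.\<close>
  have "expectation (\<lambda>w. (Y w)\<^sup>2) = expectation (\<lambda>w. if \<bar>fst w - x\<bar> \<le> h then (snd w)\<^sup>2 else 0)"
    by (intro Bochner_Integration.integral_cong) (auto simp: Y_def)
  also have "\<dots> = integral ?W (\<lambda>t. dens Q (t, 1) + dens Q (t, -1))"
    using expectation_window[OF Q, of "\<lambda>s. s\<^sup>2" x h] by simp
  also have "\<dots> \<le> 4 * C * h"
  proof -
    have C0: "0 \<le> C"
      using D(2)[of "(0, 1)"] C[of "(0, 1)"] by (simp add: Omega_def)
    have "norm (integral ?W (\<lambda>t. dens Q (t, 1) + dens Q (t, -1))) \<le> (2 * C) * (min 1 (x + h) - max 0 (x - h))"
    proof (rule integral_bound)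
      show "max 0 (x - h) \<le> min 1 (x + h)"
        using x h by auto
      show "continuous_on ?W (\<lambda>t. dens Q (t, 1) + dens Q (t, -1))"
        by (intro continuous_intros continuous_on_subset[OF C1_Omega_continuous[OF D(1)]]) auto
      show "norm (dens Q (t, 1) + dens Q (t, -1)) \<le> 2 * C" if "t \<in> ?W" for t
        using that C[of "(t, 1)"] C[of "(t, -1)"] D(2)[of "(t, 1)"] D(2)[of "(t, -1)"]
        by (auto simp: Omega_def)
    qed
    also have "\<dots> \<le> (2 * C) * (2 * h)"
      using C0 by (intro mult_left_mono) auto
    finally show ?thesis by simp
  qed
  finally have EY2: "expectation (\<lambda>w. (Y w)\<^sup>2) \<le> 4 * C * h" .
  have S: "window_sum n h w x = (\<Sum>i<n. Y (w i))" for w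
    by (simp add: window_sum_def Y_def)
  have "emeasure ?P {w \<in> space ?P. x < a \<and> 0 \<le> window_sum n h w x \<or> a < x \<and> window_sum n h w x < 0}
    \<le> emeasure ?P {w \<in> space ?P. real n * c \<le> \<bar>(\<Sum>i<n. Y (w i)) - real n * expectation Y\<bar>}"
  proof (rule emeasure_mono)
    have nc: "real n * c \<le> real n * (sgn (x - a) * expectation Y)"
      unfolding EY by (rule mult_left_mono[OF le]) simp
    show "{w \<in> space ?P. x < a \<and> 0 \<le> window_sum n h w x \<or> a < x \<and> window_sum n h w x < 0}
      \<subseteq> {w \<in> space ?P. real n * c \<le> \<bar>(\<Sum>i<n. Y (w i)) - real n * expectation Y\<bar>}"
      using nc by (auto simp: S)
    show "{w \<in> space ?P. real n * c \<le> \<bar>(\<Sum>i<n. Y (w i)) - real n * expectation Y\<bar>} \<in> sets ?P"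
      unfolding product_power_def by measurable
  qed
  also have "\<dots> \<le> ennreal (expectation (\<lambda>w. (Y w)\<^sup>2) / (real n * c\<^sup>2))"
    by (rule product_power_mean_deviation[OF Ymeas bdd n c])
  also have "\<dots> \<le> ennreal (4 * C * h / (real n * c\<^sup>2))"
    by (intro ennreal_leI divide_right_mono EY2) auto
  finally show ?thesis .
qed

section \<open>The deviation bound for a single distribution\<close>

definition crossing_slope :: "(real \<times> real) measure \<Rightarrow> real" where
  "crossing_slope Q = partial1 (dens Q) (crossing Q, 1) - partial1 (dens Q) (crossing Q, -1)"

lemma Ptilde_deriv:
  assumes "Q \<in> Ptilde" "s \<in> {-1, 1}" "x \<in> {0..1}"
  shows "((\<lambda>t. dens Q (t, s)) has_real_derivative partial1 (dens Q) (x, s)) (at x within {0..1})"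
proof -
  have "(\<lambda>t. dens Q (t, s)) differentiable (at x within {0..1})"
    using is_C1_density_dens[OF assms(1)] assms(2,3)
    by (auto simp: is_C1_density_def C1_Omega_def differentiable_on_def)
  then show ?thesis
    by (simp add: partial1_def vector_derivative_works has_real_derivative_iff_has_vector_derivative)
qed

lemma crossing_props:
  assumes "Q \<in> calP"
  shows "Q \<in> Ptilde" "0 < crossing Q" "crossing Q < 1" "dens Q (crossing Q, 1) = dens Q (crossing Q, -1)"
    "\<And>t. t \<in> {0..1} \<Longrightarrow> dens Q (t, 1) = dens Q (t, -1) \<Longrightarrow> t = crossing Q" "0 < crossing_slope Q"
proof -
  have ex1: "\<exists>!x. x \<in> {0..1} \<and> dens Q (x, 1) = dens Q (x, -1)"
    using assms by (simp add: calP_def)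
  show "Q \<in> Ptilde" "0 < crossing Q" "crossing Q < 1" "0 < crossing_slope Q"
    using assms by (auto simp: calP_def crossing_slope_def)
  show "dens Q (crossing Q, 1) = dens Q (crossing Q, -1)"
    using theI'[OF ex1] by (simp add: crossing_def)
  show "t = crossing Q" if "t \<in> {0..1}" "dens Q (t, 1) = dens Q (t, -1)" for t
    using the1_equality[OF ex1, of t] that by (simp add: crossing_def)
qed

text \<open>The wrong-sign probabilities are integrated over \<open>x\<close> in the two regimes of
  distance from the crossing point. The width of the near regime and the threshold for
  \<open>n\<close> may depend on \<open>Q\<close>; the main term involves \<open>Q\<close> only
  through \<open>C\<close> and the slope. All other contributions go into
  \<open>\<epsilon>\<close>.\<close>

lemma sign_change_estimator_deviation:
  assumes Q: "Q \<in> calP" and C0: "C > 0" and C: "\<And>w. w \<in> Omega \<Longrightarrow> dens Q w \<le> C"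
    and L: "L > 0" and T: "T > 0" and \<epsilon>: "\<epsilon> > 0"
  shows "\<forall>\<^sub>F n in sequentially. emeasure (product_power Q n) {w \<in> space (product_power Q n).
      T < real n powr (1/3) * \<bar>sign_change_estimator n (L / real n powr (1/3)) w - crossing Q\<bar>}
    \<le> ennreal (4 * pi * sqrt C / (T * crossing_slope Q * sqrt L) + \<epsilon>)"
proof -
  note Qp = crossing_props[OF Q]
  interpret prob_space Q
    using Qp by (simp add: Ptilde_def)
  define a where "a = crossing Q"
  define m where "m = crossing_slope Q"
  define g where "g t = dens Q (t, 1) - dens Q (t, -1)" for t
  have m: "m > 0" and a: "0 < a" "a < 1"
    using Qp by (auto simp: m_def a_def)
  \<comment> \<open>makes the contribution of the range \<open>\<bar>x - a\<bar> \<le> 4 e h / m\<close> at most \<open>\<epsilon> / 2\<close>\<close>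
  define e where "e = min (m / 4) (\<epsilon> * T * m / (16 * L))"
  have e: "0 < e" "e \<le> m / 4" "16 * L * e \<le> \<epsilon> * T * m"
    using m \<epsilon> T L by (auto simp: e_def min_def field_simps)
  have C1: "C1_Omega (dens Q)"
    using is_C1_density_dens[OF Qp(1)] by (simp add: is_C1_density_def)
  have "continuous_on {0..1} g"
    unfolding g_def by (intro continuous_intros C1_Omega_continuous[OF C1]) auto
  moreover have "g a = 0" "\<And>t. t \<in> {0..1} \<Longrightarrow> g t = 0 \<Longrightarrow> t = a"
    using Qp(4,5) by (auto simp: g_def a_def)
  moreover have "(g has_real_derivative m) (at a within {0..1})"
    unfolding g_def m_def crossing_slope_def a_def using Qp(2,3)
    by (intro DERIV_diff Ptilde_deriv Qp(1)) auto
  ultimately obtain \<delta> \<gamma> where \<delta>: "0 < \<delta>" and \<gamma>: "0 < \<gamma>"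
    and near: "\<And>x h. \<lbrakk>0 < h; h \<le> \<delta>; x \<in> {0..1}; \<bar>x - a\<bar> \<le> 2 * \<delta>; 4 * e * h / m \<le> \<bar>x - a\<bar>\<rbrakk> \<Longrightarrow>
      m * h * \<bar>x - a\<bar> \<le> sgn (x - a) * integral {max 0 (x - h)..min 1 (x + h)} g"
    and far: "\<And>x h. \<lbrakk>0 < h; h \<le> \<delta>; x \<in> {0..1}; 2 * \<delta> < \<bar>x - a\<bar>\<rbrakk> \<Longrightarrow>
      \<gamma> * h \<le> sgn (x - a) * integral {max 0 (x - h)..min 1 (x + h)} g"
    using crossing_window_bounds[OF _ a _ _ _ e(1,2)] by blast
  define r where "r n = real n powr (1/3)" for n
  have r_top: "filterlim r at_top sequentially"
    unfolding filterlim_at_top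
  proof
    fix Z :: real
    define c where "c = \<bar>Z\<bar> + 1"
    have "c > 0"
      by (simp add: c_def)
    then have "c powr 3 = c ^ 3"
      by simp
    moreover have "(c powr 3) powr (1/3) = c"
      unfolding powr_powr using \<open>c > 0\<close> by simp
    ultimately have "Z \<le> r n" if "c ^ 3 \<le> real n" for n
      using powr_mono2[OF _ _ that, of "1/3"] by (auto simp: r_def c_def)
    then show "\<forall>\<^sub>F n in sequentially. Z \<le> r n"
      using eventually_ge_at_top[of "nat \<lceil>c ^ 3\<rceil>"] by (auto elim!: eventually_mono simp: nat_ceiling_le_eq)
  qed
  \<comment> \<open>The first bound on \<open>r n\<close> ensures \<open>h \<le> \<delta>\<close>;
    the second makes the contribution of the points far from \<open>a\<close> at most
    \<open>\<epsilon> / 2\<close>.\<close>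
  have "\<forall>\<^sub>F n in sequentially. max (L / \<delta>) (8 * C / (\<gamma>\<^sup>2 * L * T * \<epsilon>)) \<le> r n"
    using r_top unfolding filterlim_at_top by blast
  moreover have "\<forall>\<^sub>F n in sequentially. n > 0"
    by (rule eventually_gt_at_top)
  ultimately show ?thesis
  proof eventually_elim
    case (elim n)
    have rp: "r n > 0" and n3: "real n = (r n) ^ 3"
      using elim(2) by (auto simp: r_def powr_power)
    define h where "h = L / r n"
    have h: "0 < h" "h \<le> \<delta>"
      using elim(1) rp \<delta> L by (auto simp: h_def field_simps)
    \<comment> \<open>With \<open>n = (r n)^3\<close> and \<open>h = L / r n\<close>, the Chebyshev
      bound \<open>4 * C * h / (n * c^2)\<close> becomes \<open>B^2 / (x - a)^2\<close> for
      \<open>c = m * h * \<bar>x - a\<bar>\<close> and \<open>D\<close> for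
      \<open>c = \<gamma> * h\<close>.\<close>
    define B where "B = 2 * sqrt C / (m * sqrt L * r n)"
    define D where "D = 4 * C / (\<gamma>\<^sup>2 * L * (r n)\<^sup>2)"
    have B: "B > 0" and D: "D \<ge> 0"
      using C0 m L rp \<gamma> by (auto simp: B_def D_def)
    let ?P = "product_power Q n"
    interpret P: prob_space ?P
      unfolding product_power_def by (intro prob_space_PiM prob_space_axioms)
    let ?wrong = "\<lambda>x. emeasure ?P {w \<in> space ?P. x < a \<and> 0 \<le> window_sum n h w x \<or> a < x \<and> window_sum n h w x < 0}"
    have wrong: "?wrong x \<le> ennreal (4 * C * h / (real n * c\<^sup>2))"
      if "x \<in> {0..1}" "c > 0" "c \<le> sgn (x - a) * integral {max 0 (x - h)..min 1 (x + h)} g" for x c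
      using that wrong_sign_probability[OF Qp(1) C elim(2) h(1) that(1,2)] by (simp add: g_def[abs_def])
    have "emeasure ?P {w \<in> space ?P. T < r n * \<bar>sign_change_estimator n h w - a\<bar>}
      \<le> ennreal (r n / T) * (\<integral>\<^sup>+x\<in>{0..1}. ?wrong x \<partial>lborel)"
      unfolding sign_change_estimator_def
      using a by (intro emeasure_sign_change_deviation P.sigma_finite_measure_axioms
          window_sum_measurable sets_Ptilde Qp(1) rp T) auto
    also have "\<dots> \<le> ennreal (r n / T) * ennreal (2 * (4 * e * h / m) + 2 * pi * B + D)"
    proof (intro mult_left_mono nn_integral_inverse_square_truncated_le[where a=a] B D)
      fix x :: real assume x: "x \<in> {0..1}" "4 * e * h / m < \<bar>x - a\<bar>"
      have xa: "0 < \<bar>x - a\<bar>"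
        using x(2) e(1) h(1) m by (smt (verit) divide_nonneg_pos mult_nonneg_nonneg)
      show "?wrong x \<le> max (ennreal (B\<^sup>2 / (x - a)\<^sup>2)) (ennreal D)"
      proof (cases "\<bar>x - a\<bar> \<le> 2 * \<delta>")
        case True
        have "?wrong x \<le> ennreal (4 * C * h / (real n * (m * h * \<bar>x - a\<bar>)\<^sup>2))"
          using near[OF h x(1) True] x m h xa by (intro wrong) auto
        also have "4 * C * h / (real n * (m * h * \<bar>x - a\<bar>)\<^sup>2) = B\<^sup>2 / (x - a)\<^sup>2"
        proof -
          have "4 * C * (L / R) / (R ^ 3 * (m * (L / R) * \<bar>y\<bar>)\<^sup>2) = (2 * sqrt C / (m * sqrt L * R))\<^sup>2 / y\<^sup>2"
            if "R > 0" "y \<noteq> 0" for R y :: real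
            using that C0 m L by (simp add: power_mult_distrib power_divide) (simp add: field_simps eval_nat_numeral)
          then show ?thesis
            using rp xa unfolding B_def h_def n3 by simp
        qed
        finally show ?thesis by (simp add: le_max_iff_disj)
      next
        case False
        then have "?wrong x \<le> ennreal (4 * C * h / (real n * (\<gamma> * h)\<^sup>2))"
          using far[OF h x(1)] \<gamma> h x by (intro wrong) auto
        also have "4 * C * h / (real n * (\<gamma> * h)\<^sup>2) = D"
          using \<gamma> L rp unfolding D_def h_def n3
          by (simp add: power_mult_distrib power_divide) (simp add: field_simps eval_nat_numeral)
        finally show ?thesis by (simp add: le_max_iff_disj)
      qed
    qed (use e h m in \<open>auto intro: P.emeasure_le_1\<close>)
    also have "\<dots> = ennreal (r n / T * (2 * (4 * e * h / m) + 2 * pi * B + D))"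
      using rp T by (intro ennreal_mult'[symmetric]) auto
    \<comment> \<open>Since \<open>r n * h = L\<close> and \<open>r n * B\<close> is constant, the
      first two summands are free of \<open>n\<close>; the third decays like
      \<open>1 / r n\<close>.\<close>
    also have "\<dots> \<le> ennreal (4 * pi * sqrt C / (T * m * sqrt L) + \<epsilon>)"
    proof (rule ennreal_leI)
      have "r n / T * (2 * (4 * e * h / m)) = 8 * L * e / (m * T)"
        using rp by (simp add: h_def mult_ac)
      also have "\<dots> \<le> \<epsilon> / 2"
        using e(3) m T by (simp add: field_simps)
      finally have 1: "r n / T * (2 * (4 * e * h / m)) \<le> \<epsilon> / 2" .
      have 2: "r n / T * (2 * pi * B) = 4 * pi * sqrt C / (T * m * sqrt L)"
        using rp by (simp add: B_def)
      have "r n / T * D = 4 * C / (\<gamma>\<^sup>2 * L * T * r n)"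
        using rp by (simp add: D_def power2_eq_square)
      also have "\<dots> \<le> \<epsilon> / 2"
        using elim(1) \<gamma> L T \<epsilon> rp by (simp add: field_simps)
      finally have "r n / T * D \<le> \<epsilon> / 2" .
      with 1 2 show "r n / T * (2 * (4 * e * h / m) + 2 * pi * B + D) \<le> 4 * pi * sqrt C / (T * m * sqrt L) + \<epsilon>"
        by (simp only: distrib_left)
    qed
    finally show ?case
      by (simp add: a_def m_def r_def h_def)
  qed
qed

section \<open>Uniform constants on a neighbourhood\<close>

lemma P_dist_bounds:
  assumes "P \<in> Ptilde" "Q \<in> Ptilde" "w \<in> Omega"
  shows "\<bar>dens P w - dens Q w\<bar> \<le> P_dist P Q"
    and "\<bar>partial1 (dens P) w - partial1 (dens Q) w\<bar> \<le> P_dist P Q"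
proof -
  have c: "continuous_on {0..1} (\<lambda>x. dens R (x, s))" "continuous_on {0..1} (\<lambda>x. partial1 (dens R) (x, s))"
    if "R \<in> Ptilde" "s \<in> {-1, 1}" for R s
  proof -
    have "C1_Omega (dens R)"
      using is_C1_density_dens[OF that(1)] by (simp add: is_C1_density_def)
    then show "continuous_on {0..1} (\<lambda>x. dens R (x, s))" "continuous_on {0..1} (\<lambda>x. partial1 (dens R) (x, s))"
      using that(2) C1_Omega_continuous[of "dens R" s] by (blast, unfold C1_Omega_def) blast
  qed
  have cont: "continuous_on {0..1} (\<lambda>x. dens P (x, s) - dens Q (x, s))"
      "continuous_on {0..1} (\<lambda>x. partial1 (dens P) (x, s) - partial1 (dens Q) (x, s))"
    if "s \<in> {-1, 1}" for s
    by (intro continuous_on_diff c assms that)+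
  have "\<bar>dens P w - dens Q w\<bar> \<le> sup_norm_Omega (\<lambda>w. dens P w - dens Q w)"
    "\<bar>partial1 (dens P) w - partial1 (dens Q) w\<bar> \<le> sup_norm_Omega (\<lambda>w. partial1 (dens P) w - partial1 (dens Q) w)"
    unfolding sup_norm_Omega_def
    by (rule cSUP_upper[OF assms(3) sup_norm_Omega_bdd], rule cont, assumption)+
  moreover have "0 \<le> sup_norm_Omega (\<lambda>w. dens P w - dens Q w)"
    "0 \<le> sup_norm_Omega (\<lambda>w. partial1 (dens P) w - partial1 (dens Q) w)"
    by (rule sup_norm_Omega_nonneg, rule cont, assumption)+
  ultimately show "\<bar>dens P w - dens Q w\<bar> \<le> P_dist P Q"
    "\<bar>partial1 (dens P) w - partial1 (dens Q) w\<bar> \<le> P_dist P Q"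
    using assms by (auto simp: P_dist_def)
qed

text \<open>The density bound survives a small change in the sup norm. For the slope, the crossing
  point of \<open>Q\<close> is confined to the points where the derivative difference of
  \<open>P\<close> exceeds half its slope at the crossing; closeness of the derivatives then carries
  a lower bound over to \<open>Q\<close>.\<close>

lemma calP_neighbourhood:
  assumes P: "P \<in> calP"
  obtains N C m where "is_neighbourhood calP_topology P N" "C > 0" "m > 0"
    "\<forall>Q\<in>N. Q \<in> calP \<and> (\<forall>w\<in>Omega. dens Q w \<le> C) \<and> m \<le> crossing_slope Q"
proof -
  interpret Metric_space Ptilde P_dist
    by (rule Metric_space_Ptilde)
  note Pp = crossing_props[OF P]
  have C1: "C1_Omega (dens P)"
    using is_C1_density_dens[OF Pp(1)] by (simp add: is_C1_density_def)
  \<comment> \<open>A quarter of the slope of \<open>P\<close>: the crossing point of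
    \<open>P\<close> has slope \<open>4 * m\<close> and so lies outside the set \<open>K\<close> of
    points with derivative difference at most \<open>2 * m\<close>, and passing from
    \<open>P\<close> to \<open>Q\<close> may still cost another \<open>m\<close>.\<close>
  define m where "m = crossing_slope P / 4"
  have m: "m > 0"
    using Pp by (simp add: m_def)
  \<comment> \<open>the difference of the two densities of \<open>P\<close> has no zero in \<open>K\<close>, so for \<open>Q\<close> close to \<open>P\<close> the
    crossing point lies outside \<open>K\<close>\<close>
  define K where "K = {t \<in> {0..1}. partial1 (dens P) (t, 1) - partial1 (dens P) (t, -1) \<le> 2 * m}"
  have "\<exists>\<eta>>0. \<forall>t\<in>K. \<eta> \<le> \<bar>dens P (t, 1) - dens P (t, -1)\<bar>"
  proof (cases "K = {}")
    case False
    have "continuous_on {0..1} (\<lambda>t. partial1 (dens P) (t, 1) - partial1 (dens P) (t, -1))"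
      using C1 by (intro continuous_intros) (auto simp: C1_Omega_def)
    then have "closed ({0..1} \<inter> (\<lambda>t. partial1 (dens P) (t, 1) - partial1 (dens P) (t, -1)) -` {..2 * m})"
      by (rule continuous_closed_preimage) auto
    also have "\<dots> = K"
      by (auto simp: K_def)
    finally have "closed K" .
    then have "compact K"
      unfolding compact_eq_bounded_closed
      by (auto intro: bounded_subset[OF bounded_closed_interval[of 0 1]] simp: K_def)
    moreover have "continuous_on K (\<lambda>t. \<bar>dens P (t, 1) - dens P (t, -1)\<bar>)"
      by (intro continuous_intros continuous_on_subset[OF C1_Omega_continuous[OF C1]]) (auto simp: K_def)
    ultimately obtain s where s: "s \<in> K"
        "\<And>t. t \<in> K \<Longrightarrow> \<bar>dens P (s, 1) - dens P (s, -1)\<bar> \<le> \<bar>dens P (t, 1) - dens P (t, -1)\<bar>"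
      using continuous_attains_inf[OF _ False] by blast
    have "s \<noteq> crossing P"
      using s(1) m by (auto simp: K_def m_def crossing_slope_def)
    then have "\<bar>dens P (s, 1) - dens P (s, -1)\<bar> > 0"
      using Pp(5)[of s] s(1) by (auto simp: K_def)
    with s(2) show ?thesis by blast
  qed (auto intro: exI[of _ 1])
  then obtain \<eta> where \<eta>: "\<eta> > 0" "\<And>t. t \<in> K \<Longrightarrow> \<eta> \<le> \<bar>dens P (t, 1) - dens P (t, -1)\<bar>"
    by blast
  \<comment> \<open>Differences between the two signs change by less than
    \<open>2 * \<epsilon>\<close>, as each sign contributes one \<open>\<epsilon>\<close>; hence the
    halves.\<close>
  define \<epsilon> where "\<epsilon> = min (\<eta> / 2) (m / 2)"
  have \<epsilon>: "\<epsilon> > 0" "2 * \<epsilon> \<le> \<eta>" "2 * \<epsilon> \<le> m"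
    using \<eta> m by (auto simp: \<epsilon>_def)
  define C where "C = \<bar>sup_norm_Omega (dens P)\<bar> + \<epsilon>"
  define N where "N = mball P \<epsilon> \<inter> calP"
  show thesis
  proof (rule that)
    have "openin calP_topology N"
      unfolding calP_topology_def openin_subtopology N_def by blast
    moreover have "P \<in> N"
      using P Pp(1) \<epsilon> by (simp add: N_def)
    ultimately show "is_neighbourhood calP_topology P N"
      unfolding is_neighbourhood_def topspace_calP_topology by (auto simp: N_def)
    show "C > 0"
      using \<epsilon> by (simp add: C_def)
    show "m > 0"
      by fact
    show "\<forall>Q\<in>N. Q \<in> calP \<and> (\<forall>w\<in>Omega. dens Q w \<le> C) \<and> m \<le> crossing_slope Q"
    proof
      fix Q assume "Q \<in> N"
      then have Q: "Q \<in> calP" and dist: "P_dist P Q < \<epsilon>"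
        by (auto simp: N_def)
      note Qp = crossing_props[OF Q]
      have near: "\<bar>dens P w - dens Q w\<bar> < \<epsilon>" "\<bar>partial1 (dens P) w - partial1 (dens Q) w\<bar> < \<epsilon>"
        if "w \<in> Omega" for w
        using P_dist_bounds[OF Pp(1) Qp(1) that] dist by linarith+
      have "dens Q w \<le> C" if w: "w \<in> Omega" for w
      proof -
        have "\<bar>dens P w\<bar> \<le> sup_norm_Omega (dens P)"
          unfolding sup_norm_Omega_def
          by (rule cSUP_upper[OF w sup_norm_Omega_bdd]) (rule C1_Omega_continuous[OF C1])
        then show ?thesis
          using near(1)[OF w] by (auto simp: C_def)
      qed
      moreover have "m \<le> crossing_slope Q"
      proof -
        define b where "b = crossing Q"
        have b: "b \<in> {0..1}" "(b, 1) \<in> Omega" "(b, -1) \<in> Omega"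
          using Qp by (auto simp: b_def Omega_def)
        \<comment> \<open>The two densities of \<open>Q\<close> agree at \<open>b\<close>, so those
          of \<open>P\<close> nearly agree there, which rules out \<open>b\<close> in
          \<open>K\<close>.\<close>
        have "\<bar>dens P (b, 1) - dens P (b, -1)\<bar> < \<eta>"
          using near(1)[OF b(2)] near(1)[OF b(3)] Qp(4) \<epsilon> unfolding b_def[symmetric] by linarith
        then have "b \<notin> K"
          using \<eta>(2)[of b] by auto
        then have "partial1 (dens P) (b, 1) - partial1 (dens P) (b, -1) > 2 * m"
          using b by (auto simp: K_def)
        then show ?thesis
          using near(2)[OF b(2)] near(2)[OF b(3)] \<epsilon> unfolding crossing_slope_def b_def[symmetric] by linarith
      qed
      ultimately show "Q \<in> calP \<and> (\<forall>w\<in>Omega. dens Q w \<le> C) \<and> m \<le> crossing_slope Q"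
        using Q by blast
    qed
  qed
qed

section \<open>Passing to the limit in \<open>n\<close> and then in \<open>L\<close>\<close>

theorem theorem1p3:
  shows "\<exists>ahat :: nat \<Rightarrow> real \<Rightarrow> (nat \<Rightarrow> real \<times> real) \<Rightarrow> real.
    (\<forall>n. \<forall>L>0. is_estimator n (ahat n L)) \<and>
    (\<forall>P\<in>calP. \<exists>N. is_neighbourhood calP_topology P N \<and>
      (\<forall>T>0.
        ((\<lambda>L. SUP Q\<in>N. limsup (\<lambda>n.
            emeasure (product_power Q n)
              {w \<in> space (product_power Q n).
                 real n powr (1/3) * \<bar>ahat n L w - crossing Q\<bar> > T}))
          \<longlongrightarrow> 0) at_top))"
\<comment> \<open>For \<open>n = 0\<close> the bandwidth is a division by zero, hence 0; the
  estimator is still measurable, and the limit superior ignores this case.\<close>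
proof (intro exI[of _ "\<lambda>n L. sign_change_estimator n (L / real n powr (1/3))"] conjI allI impI ballI)
  show "is_estimator n (sign_change_estimator n (L / real n powr (1/3)))" for n and L :: real
    by (rule sign_change_estimator_measurable)
  fix P assume "P \<in> calP"
  then obtain N C m where N: "is_neighbourhood calP_topology P N" and C: "C > 0" and m: "m > 0"
    and unif: "\<forall>Q\<in>N. Q \<in> calP \<and> (\<forall>w\<in>Omega. dens Q w \<le> C) \<and> m \<le> crossing_slope Q"
    by (rule calP_neighbourhood)
  show "\<exists>N. is_neighbourhood calP_topology P N \<and>
      (\<forall>T>0. ((\<lambda>L. SUP Q\<in>N. limsup (\<lambda>n. emeasure (product_power Q n)
              {w \<in> space (product_power Q n).
                 real n powr (1/3) * \<bar>sign_change_estimator n (L / real n powr (1/3)) w - crossing Q\<bar> > T}))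
          \<longlongrightarrow> 0) at_top)"
  proof (intro exI[of _ N] conjI N allI impI)
    fix T :: real assume T: "T > 0"
    define dev where "dev L Q = (\<lambda>n. emeasure (product_power Q n) {w \<in> space (product_power Q n).
        real n powr (1/3) * \<bar>sign_change_estimator n (L / real n powr (1/3)) w - crossing Q\<bar> > T})" for L Q
    \<comment> \<open>The limit superior is taken for each \<open>Q\<close> before the supremum, so
      the threshold for \<open>n\<close> need not be uniform. The arbitrary slack
      \<open>\<epsilon>\<close> disappears, and the remaining bound depends on \<open>N\<close> only
      through \<open>C\<close> and \<open>m\<close>.\<close>
    have bound: "(SUP Q\<in>N. limsup (dev L Q)) \<le> ennreal (4 * pi * sqrt C / (T * m) / sqrt L)" if L: "L > 0" for L
    proof (rule SUP_least, rule ennreal_le_epsilon)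
      fix Q and \<epsilon> :: real assume "Q \<in> N" and \<epsilon>: "\<epsilon> > 0"
      with unif have Q: "Q \<in> calP" "\<And>w. w \<in> Omega \<Longrightarrow> dens Q w \<le> C" "m \<le> crossing_slope Q"
        by auto
      have "limsup (dev L Q) \<le> ennreal (4 * pi * sqrt C / (T * crossing_slope Q * sqrt L) + \<epsilon>)"
        unfolding dev_def by (intro Limsup_bounded sign_change_estimator_deviation Q C L T \<epsilon>)
      also have "\<dots> \<le> ennreal (4 * pi * sqrt C / (T * m) / sqrt L + \<epsilon>)"
      proof -
        have "4 * pi * sqrt C / (T * crossing_slope Q * sqrt L) \<le> 4 * pi * sqrt C / (T * m * sqrt L)"
          using Q(3) m T L C by (intro divide_left_mono mult_right_mono mult_left_mono mult_pos_pos) auto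
        then show ?thesis
          by (intro ennreal_leI) simp
      qed
      also have "\<dots> = ennreal (4 * pi * sqrt C / (T * m) / sqrt L) + ennreal \<epsilon>"
        using \<epsilon> C T m L by (intro ennreal_plus) auto
      finally show "limsup (dev L Q) \<le> ennreal (4 * pi * sqrt C / (T * m) / sqrt L) + ennreal \<epsilon>" .
    qed
    have "((\<lambda>L. 4 * pi * sqrt C / (T * m) / sqrt L) \<longlongrightarrow> 0) at_top"
      by (intro tendsto_divide_0[OF tendsto_const] filterlim_at_top_imp_at_infinity sqrt_at_top)
    then have "((\<lambda>L. ennreal (4 * pi * sqrt C / (T * m) / sqrt L)) \<longlongrightarrow> ennreal 0) at_top"
      by (rule tendsto_ennrealI)
    then have lim: "((\<lambda>L. ennreal (4 * pi * sqrt C / (T * m) / sqrt L)) \<longlongrightarrow> 0) at_top"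
      by simp
    have "((\<lambda>L. SUP Q\<in>N. limsup (dev L Q)) \<longlongrightarrow> 0) at_top"
      by (rule tendsto_sandwich[OF _ eventually_mono[OF eventually_gt_at_top[of 0] bound] tendsto_const lim]) auto
    then show "((\<lambda>L. SUP Q\<in>N. limsup (\<lambda>n. emeasure (product_power Q n)
              {w \<in> space (product_power Q n).
                 real n powr (1/3) * \<bar>sign_change_estimator n (L / real n powr (1/3)) w - crossing Q\<bar> > T}))
          \<longlongrightarrow> 0) at_top"
      unfolding dev_def .
  qed
qed

end
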